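(* For directed $d$-dimensional grids of size $n_1\times n_2\times\cdots\times n_d$ with $n_1\le n_2\le\cdots\le n_d$, and any $\epsilon>0$, $Q(\mathrm{dD\text{-}DConnectivity}_{n_1,n_2,\dots,n_d})=\Omega\big((n_{d-1}\prod_{i=1}^d n_i)^{\frac12-\epsilon}\big)$.
   Context: The directed $n_1\times\cdots\times n_d$ grid has vertices $(x_1,\dots,x_d)$ with $x_i\in\{0,1,\dots,n_i\}$ and directed edges from each vertex to the vertex obtained by increasing exactly one coordinate $x_i$ by $1$ (when $x_i<n_i$). An input is a subgraph $G$ of this grid, described by one bit $x_e$ per grid edge $e$ ($x_e=1$ iff $e\in G$). $\mathrm{dD\text{-}DConnectivity}_{n_1,\dots,n_d}(x)=1$ iff $G$ contains a directed path from $(0,\dots,0)$ to $(n_1,\dots,n_d)$. $Q(g)$ denotes the bounded-error (success probability at least $2/3$) quantum query complexity of $g$. *)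

theory Defs
  imports Complex_Main
begin

text \<open>
  Quantum query algorithms for Boolean functions of the bits \<open>x\<^sub>e\<close> (\<open>e \<in> E\<close>, \<open>E\<close> finite).
  A bit assignment is identified with its support \<open>G \<subseteq> E\<close>, that is, \<open>x\<^sub>e = 1\<close> iff \<open>e \<in> G\<close>.
  The computational basis consists of the triples \<open>(e, b, w)\<close> of a queried index, an answer
  bit, and a content of a work register of some finite dimension \<open>m\<close>. State vectors and operators
  are given by their coefficients in this basis, and only coefficients inside the basis matter.
\<close>

type_synonym 'e state = "'e \<times> bool \<times> nat \<Rightarrow> complex"
type_synonym 'e operator = "'e \<times> bool \<times> nat \<Rightarrow> 'e \<times> bool \<times> nat \<Rightarrow> complex"

definition query_basis :: "'e set \<Rightarrow> nat \<Rightarrow> ('e \<times> bool \<times> nat) set" where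
  "query_basis E m = E \<times> (UNIV :: bool set) \<times> {..<m}"

definition basis_state :: "'e \<times> bool \<times> nat \<Rightarrow> 'e state" where
  "basis_state s = (\<lambda>i. if i = s then 1 else 0)"

definition apply_operator :: "('e \<times> bool \<times> nat) set \<Rightarrow> 'e operator \<Rightarrow> 'e state \<Rightarrow> 'e state" where
  "apply_operator B U \<psi> = (\<lambda>i. \<Sum>j\<in>B. U i j * \<psi> j)"

text \<open>The condition below says that the adjoint of \<open>U\<close> is a left inverse of \<open>U\<close>; as \<open>B\<close> will be
  finite, it is then a two-sided inverse.\<close>

definition unitary_on :: "('e \<times> bool \<times> nat) set \<Rightarrow> 'e operator \<Rightarrow> bool" where
  "unitary_on B U \<longleftrightarrow>
     (\<forall>i\<in>B. \<forall>j\<in>B. (\<Sum>k\<in>B. cnj (U k i) * U k j) = (if i = j then 1 else 0))"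

text \<open>The query maps the basis vector \<open>(e, b, w)\<close> to \<open>(e, b XOR x\<^sub>e, w)\<close>. This map is an involution,
  so the new coefficient at \<open>(e, b, w)\<close> is the old one at \<open>(e, b XOR x\<^sub>e, w)\<close>.\<close>

definition query :: "'e set \<Rightarrow> 'e state \<Rightarrow> 'e state" where
  "query G \<psi> = (\<lambda>(e, b, w). \<psi> (e, b \<noteq> (e \<in> G), w))"

primrec run_query_algorithm ::
  "('e \<times> bool \<times> nat) set \<Rightarrow> (nat \<Rightarrow> 'e operator) \<Rightarrow> 'e \<times> bool \<times> nat \<Rightarrow> 'e set \<Rightarrow> nat \<Rightarrow> 'e state" where
  "run_query_algorithm B U s G 0 = apply_operator B (U 0) (basis_state s)"
| "run_query_algorithm B U s G (Suc t) =
     apply_operator B (U (Suc t)) (query G (run_query_algorithm B U s G t))"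

text \<open>Exactly \<open>T\<close> queries are made, after which the final state is measured in the computational
  basis; the output is 1 iff the outcome lies in \<open>A\<close>. The unitaries, \<open>s\<close> and \<open>A\<close> do not depend on
  the input \<open>G\<close>.\<close>

definition bounded_error_computable :: "'e set \<Rightarrow> ('e set \<Rightarrow> bool) \<Rightarrow> nat \<Rightarrow> bool" where
  "bounded_error_computable E g T \<longleftrightarrow>
     (\<exists>m U s A. s \<in> query_basis E m \<and>
        (\<forall>t\<le>T. unitary_on (query_basis E m) (U t)) \<and>
        (\<forall>G\<subseteq>E. (\<Sum>i\<in>{i \<in> query_basis E m. i \<in> A \<longleftrightarrow> g G}.
                   (cmod (run_query_algorithm (query_basis E m) U s G T i))\<^sup>2) \<ge> 2 / 3))"

definition quantum_query_complexity :: "'e set \<Rightarrow> ('e set \<Rightarrow> bool) \<Rightarrow> nat" where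
  "quantum_query_complexity E g = (LEAST T. bounded_error_computable E g T)"

text \<open>The directed grid of size \<open>n\<^sub>1 \<times> \<dots> \<times> n\<^sub>d\<close>, with \<open>ns = [n\<^sub>1, \<dots>, n\<^sub>d]\<close>.\<close>

definition grid_vertices :: "nat list \<Rightarrow> nat list set" where
  "grid_vertices ns = {v. length v = length ns \<and> (\<forall>i<length ns. v ! i \<le> ns ! i)}"

definition grid_edges :: "nat list \<Rightarrow> (nat list \<times> nat list) set" where
  "grid_edges ns = {(u, v). u \<in> grid_vertices ns \<and> v \<in> grid_vertices ns \<and>
     (\<exists>i<length ns. v = u[i := u ! i + 1])}"

definition DConnectivity :: "nat list \<Rightarrow> (nat list \<times> nat list) set \<Rightarrow> bool" where
  "DConnectivity ns G \<longleftrightarrow> (replicate (length ns) 0, ns) \<in> G\<^sup>*"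

end

theory Submission
  imports Defs "HOL-Combinatorics.Transposition"
begin

text \<open>
  The lower bound follows from the adversary method with pairs of inputs at Hamming distance 1:
  if every input in a set \<open>X\<close> of 0-inputs has at least \<open>a\<close> neighbours in a set \<open>Y\<close> of 1-inputs, and
  every input in \<open>Y\<close> has at least \<open>b\<close> neighbours in \<open>X\<close>, then \<open>\<Omega>(\<surd>(a b))\<close> queries are needed. The
  distance is measured in hidden bits, each of which may control many edges.

  A word of \<open>N\<close> hidden bits is a walk in the plane of the two largest dimensions, a bit deciding
  between a step up and a step to the right. The edges of a diagonal strip can follow any walk that
  stays in the strip, and such a walk leaves the strip at the top iff it makes sufficiently many
  steps up. If the words are built recursively from \<open>2 m + 1\<close> blocks, \<open>m\<close> or \<open>m + 1\<close> of which
  have value 1, a strip of width \<open>O(log N)\<close> suffices, while \<open>((m + 1) / (2 m + 1))^l N\<close> of the \<open>N = (2 m + 1)^l\<close>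
  bits are sensitive, which is \<open>N\<close> to a power close to 1 for large \<open>m\<close>. Filling the grid with \<open>K\<close> parallel
  strips gives the disjunction of \<open>K\<close> such words, hence \<open>a = K s\<close> and \<open>b = s\<close> for the sensitivity \<open>s\<close>
  of one word; here \<open>s\<close> is almost \<open>n\<^sub>d\<^sub>-\<^sub>1\<close> and \<open>K\<close> almost the product of the other dimensions.
\<close>

section \<open>The adversary bound\<close>

definition inner_on :: "'a set \<Rightarrow> ('a \<Rightarrow> complex) \<Rightarrow> ('a \<Rightarrow> complex) \<Rightarrow> complex" where
  "inner_on B \<phi> \<psi> = (\<Sum>i\<in>B. cnj (\<phi> i) * \<psi> i)"

definition mass_on :: "'a set \<Rightarrow> ('a \<Rightarrow> complex) \<Rightarrow> real" where
  "mass_on B \<psi> = (\<Sum>i\<in>B. (cmod (\<psi> i))\<^sup>2)"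

lemma inner_on_self: "inner_on B \<psi> \<psi> = of_real (mass_on B \<psi>)"
  unfolding inner_on_def mass_on_def
  by (simp add: mult.commute complex_norm_square of_real_sum flip: of_real_power)

lemma inner_on_apply_operator:
  assumes "finite B" "unitary_on B U"
  shows "inner_on B (apply_operator B U \<phi>) (apply_operator B U \<psi>) = inner_on B \<phi> \<psi>"
proof -
  have "inner_on B (apply_operator B U \<phi>) (apply_operator B U \<psi>)
      = (\<Sum>k\<in>B. \<Sum>j\<in>B. \<Sum>i\<in>B. cnj (\<phi> i) * \<psi> j * (cnj (U k i) * U k j))"
    unfolding inner_on_def apply_operator_def
    by (simp add: cnj_sum sum_product mult_ac)
  also have "\<dots> = (\<Sum>k\<in>B. \<Sum>i\<in>B. \<Sum>j\<in>B. cnj (\<phi> i) * \<psi> j * (cnj (U k i) * U k j))"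
    by (intro sum.cong refl sum.swap)
  also have "\<dots> = (\<Sum>i\<in>B. \<Sum>k\<in>B. \<Sum>j\<in>B. cnj (\<phi> i) * \<psi> j * (cnj (U k i) * U k j))"
    by (rule sum.swap)
  also have "\<dots> = (\<Sum>i\<in>B. \<Sum>j\<in>B. \<Sum>k\<in>B. cnj (\<phi> i) * \<psi> j * (cnj (U k i) * U k j))"
    by (intro sum.cong refl sum.swap)
  also have "\<dots> = (\<Sum>i\<in>B. \<Sum>j\<in>B. cnj (\<phi> i) * \<psi> j * (if i = j then 1 else 0))"
    using assms(2) unfolding unitary_on_def
    by (intro sum.cong refl) (simp flip: sum_distrib_left)
  also have "\<dots> = inner_on B \<phi> \<psi>"
    unfolding inner_on_def using assms(1)
    by (intro sum.cong refl) (simp add: if_distrib[of "(*) _"] sum.delta cong: if_cong)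
  finally show ?thesis .
qed

lemma mass_on_apply_operator:
  assumes "finite B" "unitary_on B U"
  shows "mass_on B (apply_operator B U \<psi>) = mass_on B \<psi>"
  using inner_on_apply_operator[OF assms, of \<psi> \<psi>] unfolding inner_on_self
  by (simp only: of_real_eq_iff)

text \<open>Weighted AM-GM in place of Cauchy-Schwarz: the free weight \<kappa> can later be matched
  to the different degrees of 0-inputs and 1-inputs.\<close>

lemma cmod_inner_on_le:
  assumes "\<kappa> > 0"
  shows "cmod (inner_on B \<phi> \<psi>) \<le> (\<kappa> * mass_on B \<phi> + mass_on B \<psi> / \<kappa>) / 2"
proof -
  have *: "a * b \<le> (\<kappa> * a\<^sup>2 + b\<^sup>2 / \<kappa>) / 2" for a b :: real
  proof -
    have "0 \<le> (\<kappa> * a - b)\<^sup>2 / \<kappa>" using assms by simp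
    also have "\<dots> = \<kappa> * a\<^sup>2 + b\<^sup>2 / \<kappa> - 2 * (a * b)"
      using assms by (simp add: field_simps power2_eq_square)
    finally show ?thesis by simp
  qed
  have "cmod (inner_on B \<phi> \<psi>) \<le> (\<Sum>i\<in>B. cmod (\<phi> i) * cmod (\<psi> i))"
    unfolding inner_on_def by (rule order_trans[OF norm_sum]) (simp add: norm_mult)
  also have "\<dots> \<le> (\<Sum>i\<in>B. (\<kappa> * (cmod (\<phi> i))\<^sup>2 + (cmod (\<psi> i))\<^sup>2 / \<kappa>) / 2)"
    by (intro sum_mono *)
  also have "\<dots> = (\<kappa> * mass_on B \<phi> + mass_on B \<psi> / \<kappa>) / 2"
    unfolding mass_on_def by (simp add: sum.distrib sum_distrib_left flip: sum_divide_distrib)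
  finally show ?thesis .
qed

section \<open>Effect of one query\<close>

lemma finite_query_basis: "finite E \<Longrightarrow> finite (query_basis E m)"
  by (simp add: query_basis_def)

lemma sum_query_flip:
  "(\<Sum>(e, b, w)\<in>query_basis E m. f (e, b \<noteq> (e \<in> G), w)) = (\<Sum>i\<in>query_basis E m. f i)"
  by (rule sum.reindex_bij_witness[of _ "\<lambda>(e, b, w). (e, b \<noteq> (e \<in> G), w)" "\<lambda>(e, b, w). (e, b \<noteq> (e \<in> G), w)"])
     (auto simp: query_basis_def)

lemma query_query:
  assumes "fst i \<in> G \<longleftrightarrow> fst i \<in> G'"
  shows "query G (query G' \<psi>) i = \<psi> i"
proof -
  obtain e b w where i: "i = (e, b, w)" by (cases i)
  have "((b \<noteq> (e \<in> G)) \<noteq> (e \<in> G')) = b" using assms i by auto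
  then show ?thesis by (simp add: query_def i)
qed

lemma mass_on_query: "mass_on (query_basis E m) (query G \<psi>) = mass_on (query_basis E m) \<psi>"
  using sum_query_flip[of "\<lambda>i. (cmod (\<psi> i))\<^sup>2" G E m]
  by (simp add: mass_on_def query_def case_prod_unfold)

text \<open>A query permutes the basis by an involution, hence it is self-adjoint.\<close>

lemma inner_on_query:
  "inner_on (query_basis E m) (query G \<phi>) \<chi> = inner_on (query_basis E m) \<phi> (query G \<chi>)"
proof -
  have "inner_on (query_basis E m) (query G \<phi>) \<chi>
      = (\<Sum>i\<in>query_basis E m. query G (\<lambda>i. cnj (\<phi> i) * query G \<chi> i) i)"
    unfolding inner_on_def
  proof (intro sum.cong refl)
    fix i :: "'a \<times> bool \<times> nat"
    have "query G (\<lambda>i. cnj (\<phi> i) * query G \<chi> i) i = cnj (query G \<phi> i) * query G (query G \<chi>) i"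
      by (simp add: query_def case_prod_unfold)
    then show "cnj (query G \<phi> i) * \<chi> i = query G (\<lambda>i. cnj (\<phi> i) * query G \<chi> i) i"
      by (simp add: query_query)
  qed
  also have "\<dots> = inner_on (query_basis E m) \<phi> (query G \<chi>)"
    using sum_query_flip[of "\<lambda>i. cnj (\<phi> i) * query G \<chi> i" G E m]
    by (simp only: query_def[of G "\<lambda>i. cnj (\<phi> i) * query G \<chi> i"] inner_on_def)
  finally show ?thesis .
qed

text \<open>Moving the left query to the right turns \<psi> into \<open>\<psi>'\<close>, which can
  differ from \<psi> only where the queried index lies in \<open>S\<close>. On that part queries
  preserve mass, so both inner products there obey the same bound.\<close>

lemma inner_on_query_change:
  fixes S :: "'e set"
  assumes "finite E" "\<kappa> > 0" "S \<subseteq> E" "\<And>e. e \<in> E - S \<Longrightarrow> e \<in> G \<longleftrightarrow> e \<in> G'"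
    and B: "B = query_basis E m"
  shows "cmod (inner_on B (query G \<phi>) (query G' \<psi>) - inner_on B \<phi> \<psi>)
    \<le> \<kappa> * mass_on (query_basis S m) \<phi> + mass_on (query_basis S m) \<psi> / \<kappa>"
proof -
  define C where "C = query_basis S m"
  define \<psi>' where "\<psi>' = query G (query G' \<psi>)"
  have CB: "C \<subseteq> B" using assms(3) by (auto simp: B C_def query_basis_def)
  have fin: "finite B" using assms(1) by (simp add: B finite_query_basis)
  have "inner_on B (query G \<phi>) (query G' \<psi>) - inner_on B \<phi> \<psi>
     = (\<Sum>i\<in>B. cnj (\<phi> i) * (\<psi>' i - \<psi> i))"
    unfolding B inner_on_query \<psi>'_def[symmetric]
    by (simp add: inner_on_def sum_subtractf algebra_simps)
  also have "\<dots> = (\<Sum>i\<in>C. cnj (\<phi> i) * (\<psi>' i - \<psi> i))"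
  proof (rule sum.mono_neutral_right[OF fin CB], intro ballI)
    fix i assume "i \<in> B - C"
    then have "fst i \<in> E - S" by (auto simp: B C_def query_basis_def)
    then show "cnj (\<phi> i) * (\<psi>' i - \<psi> i) = 0"
      using assms(4) by (simp add: \<psi>'_def query_query)
  qed
  also have "\<dots> = inner_on C \<phi> \<psi>' - inner_on C \<phi> \<psi>"
    by (simp add: inner_on_def sum_subtractf algebra_simps)
  finally have "cmod (inner_on B (query G \<phi>) (query G' \<psi>) - inner_on B \<phi> \<psi>)
     \<le> cmod (inner_on C \<phi> \<psi>') + cmod (inner_on C \<phi> \<psi>)"
    by (simp add: norm_triangle_ineq4)
  also have "\<dots> \<le> (\<kappa> * mass_on C \<phi> + mass_on C \<psi>' / \<kappa>) / 2 + (\<kappa> * mass_on C \<phi> + mass_on C \<psi> / \<kappa>) / 2"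
    by (intro add_mono cmod_inner_on_le assms(2))
  also have "mass_on C \<psi>' = mass_on C \<psi>"
    by (simp add: C_def \<psi>'_def mass_on_query)
  finally show ?thesis by (simp add: C_def)
qed

text \<open>Each state has mass at most 1/3 where the other has at least 2/3. Weighting the small
  mass by 3/2 and the large one by 2/3 gives 3/2 * 1/3 + 2/3 * 2/3 = 17/18 in the extreme case; any
  constant below 1 would serve.\<close>

lemma cmod_inner_on_distinguished:
  assumes "finite B" "mass_on B \<phi> = 1" "mass_on B \<psi> = 1"
    and "mass_on {i \<in> B. i \<notin> A} \<phi> \<ge> 2/3" "mass_on {i \<in> B. i \<in> A} \<psi> \<ge> 2/3"
  shows "cmod (inner_on B \<phi> \<psi>) \<le> 17 / 18"
proof -
  let ?P = "{i \<in> B. i \<in> A}" and ?N = "{i \<in> B. i \<notin> A}"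
  have U: "B = ?P \<union> ?N" and D: "?P \<inter> ?N = {}" by auto
  have split: "mass_on B \<chi> = mass_on ?P \<chi> + mass_on ?N \<chi>" for \<chi> :: "'a \<Rightarrow> complex"
    using assms(1) unfolding mass_on_def by (subst U, subst sum.union_disjoint) auto
  have "inner_on B \<phi> \<psi> = inner_on ?P \<phi> \<psi> + inner_on ?N \<phi> \<psi>"
    using assms(1) unfolding inner_on_def by (subst U, subst sum.union_disjoint) auto
  then have "cmod (inner_on B \<phi> \<psi>) \<le> cmod (inner_on ?P \<phi> \<psi>) + cmod (inner_on ?N \<phi> \<psi>)"
    by (simp add: norm_triangle_ineq)
  also have "\<dots> \<le> ((3/2) * mass_on ?P \<phi> + mass_on ?P \<psi> / (3/2)) / 2
      + ((2/3) * mass_on ?N \<phi> + mass_on ?N \<psi> / (2/3)) / 2"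
    by (intro add_mono cmod_inner_on_le) auto
  also have "\<dots> \<le> 17 / 18"
    using split[of \<phi>] split[of \<psi>] assms by (simp add: field_simps)
  finally show ?thesis .
qed

section \<open>Hidden bits and the progress of an algorithm\<close>

definition flip :: "'l \<Rightarrow> 'l set \<Rightarrow> 'l set" where
  "flip l \<beta> = (if l \<in> \<beta> then \<beta> - {l} else insert l \<beta>)"

lemma flip_flip [simp]: "flip l (flip l \<beta>) = \<beta>"
  by (auto simp: flip_def)

lemma mem_flip_iff: "k \<in> flip l \<beta> \<longleftrightarrow> (if k = l then l \<notin> \<beta> else k \<in> \<beta>)"
  by (auto simp: flip_def)

lemma card_dependent_pairs_ge:
  assumes "finite X" "\<And>\<beta>. \<beta> \<in> X \<Longrightarrow> finite (F \<beta>)" "\<And>\<beta>. \<beta> \<in> X \<Longrightarrow> a \<le> card (F \<beta>)"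
  shows "card X * a \<le> card (Sigma X F)"
  using sum_mono[of X "\<lambda>_. a" "\<lambda>\<beta>. card (F \<beta>)"] assms by (simp add: card_SigmaI)

text \<open>The potential sums the absolute inner products over all pairs of a 0-input and a 1-input
  at distance 1. It starts at \<open>card R\<close>, must fall to 17/18 of that, and drops by at
  most \<open>2 * card R / r\<close> per query, where \<open>r = sqrt (a * b)\<close>. By
  \<open>loc\<close>, a flipped hidden bit affects only the edges with its label, so each state has
  total mass at most 1 to spend on all its pairs.\<close>

theorem adversary_bound:
  fixes E :: "'e set" and \<Lambda> :: "'l set" and G :: "'l set \<Rightarrow> 'e set"
  assumes comp: "bounded_error_computable E g T"
    and finE: "finite E" and fin\<Lambda>: "finite \<Lambda>"
    and XY: "X \<subseteq> Pow \<Lambda>" "Y \<subseteq> Pow \<Lambda>" "X \<noteq> {}"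
    and GE: "\<And>\<beta>. G \<beta> \<subseteq> E"
    and G0: "\<And>\<beta>. \<beta> \<in> X \<Longrightarrow> \<not> g (G \<beta>)" and G1: "\<And>\<beta>. \<beta> \<in> Y \<Longrightarrow> g (G \<beta>)"
    and loc: "\<And>e l \<beta>. e \<in> E \<Longrightarrow> lab e \<noteq> l \<Longrightarrow> e \<in> G (flip l \<beta>) \<longleftrightarrow> e \<in> G \<beta>"
    and degX: "\<And>\<beta>. \<beta> \<in> X \<Longrightarrow> a \<le> card {l \<in> \<Lambda>. flip l \<beta> \<in> Y}"
    and degY: "\<And>\<beta>. \<beta> \<in> Y \<Longrightarrow> b \<le> card {l \<in> \<Lambda>. flip l \<beta> \<in> X}"
    and pos: "a > 0" "b > 0"
  shows "sqrt (real a * real b) / 36 \<le> real T"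
proof -
  obtain m U s A where s: "s \<in> query_basis E m"
    and un: "\<forall>t\<le>T. unitary_on (query_basis E m) (U t)"
    and acc: "\<forall>G\<subseteq>E. (\<Sum>i\<in>{i \<in> query_basis E m. i \<in> A \<longleftrightarrow> g G}.
                   (cmod (run_query_algorithm (query_basis E m) U s G T i))\<^sup>2) \<ge> 2 / 3"
    using comp unfolding bounded_error_computable_def by blast
  define B where "B = query_basis E m"
  define \<psi> where "\<psi> \<beta> t = run_query_algorithm B U s (G \<beta>) t" for \<beta> t
  have finB: "finite B" using finE by (simp add: B_def finite_query_basis)
  have unB: "unitary_on B (U t)" if "t \<le> T" for t using un that by (simp add: B_def)
  have psi0: "\<psi> \<beta> 0 = apply_operator B (U 0) (basis_state s)" for \<beta> by (simp add: \<psi>_def)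
  have psiS: "\<psi> \<beta> (Suc t) = apply_operator B (U (Suc t)) (query (G \<beta>) (\<psi> \<beta> t))" for \<beta> t
    by (simp add: \<psi>_def)
  have init: "mass_on B (basis_state s) = 1"
    using s finB by (simp add: mass_on_def basis_state_def B_def if_distrib[of cmod] if_distrib[of "\<lambda>x. x\<^sup>2"] cong: if_cong)
  have mass: "mass_on B (\<psi> \<beta> t) = 1" if "t \<le> T" for \<beta> t
    using that
  proof (induction t)
    case 0
    then show ?case using init unB finB by (simp add: psi0 mass_on_apply_operator)
  next
    case (Suc t)
    then show ?case using unB[of "Suc t"] finB
      by (simp add: psiS mass_on_apply_operator) (simp add: B_def mass_on_query)
  qed

  have finX: "finite X" and finY: "finite Y"
    using XY fin\<Lambda> by (meson finite_Pow_iff finite_subset)+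
  define R where "R = (SIGMA \<beta>:X. {l \<in> \<Lambda>. flip l \<beta> \<in> Y})"
  define R' where "R' = (SIGMA \<beta>:Y. {l \<in> \<Lambda>. flip l \<beta> \<in> X})"
  \<comment> \<open>The same pairs seen from the other end: flipping the same bit leads
    back.\<close>
  have cardR': "card R' = card R"
    by (rule bij_betw_same_card[of "\<lambda>(\<beta>, l). (flip l \<beta>, l)"], rule bij_betw_byWitness[where f' = "\<lambda>(\<beta>, l). (flip l \<beta>, l)"])
       (auto simp: R_def R'_def)
  have Xa: "real (card X) * real a \<le> real (card R)"
    using card_dependent_pairs_ge[OF finX _ degX] fin\<Lambda> unfolding R_def
    by (simp flip: of_nat_mult)
  have Yb: "real (card Y) * real b \<le> real (card R)"
    using card_dependent_pairs_ge[OF finY _ degY] fin\<Lambda> unfolding cardR'[symmetric] R'_def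
    by (simp flip: of_nat_mult)
  have R0: "real (card R) > 0"
  proof -
    have "card X > 0" using XY(3) finX by (simp add: card_gt_0_iff)
    then have "0 < real (card X) * real a" using pos by simp
    then show ?thesis using Xa by linarith
  qed

  define W where "W t = (\<Sum>(\<beta>, l)\<in>R. cmod (inner_on B (\<psi> \<beta> t) (\<psi> (flip l \<beta>) t)))" for t
  have W0: "W 0 = card R"
  proof -
    have "inner_on B (\<psi> \<beta> 0) (\<psi> \<beta>' 0) = 1" for \<beta> \<beta>'
      using mass[of 0] by (simp add: psi0 inner_on_self)
    then show ?thesis by (simp add: W_def case_prod_unfold)
  qed
  have WT: "W T \<le> card R * (17 / 18)"
  proof -
    have "cmod (inner_on B (\<psi> \<beta> T) (\<psi> (flip l \<beta>) T)) \<le> 17 / 18" if "(\<beta>, l) \<in> R" for \<beta> l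
    proof (rule cmod_inner_on_distinguished[OF finB mass[OF order_refl] mass[OF order_refl], of A])
      have "\<beta> \<in> X" "flip l \<beta> \<in> Y" using that by (auto simp: R_def)
      then show "mass_on {i \<in> B. i \<notin> A} (\<psi> \<beta> T) \<ge> 2/3" "mass_on {i \<in> B. i \<in> A} (\<psi> (flip l \<beta>) T) \<ge> 2/3"
        using acc[rule_format, OF GE[of \<beta>]] acc[rule_format, OF GE[of "flip l \<beta>"]] G0 G1
        by (simp_all add: mass_on_def B_def \<psi>_def)
    qed
    then have "W T \<le> (\<Sum>(\<beta>, l)\<in>R. 17 / 18)" unfolding W_def by (intro sum_mono) auto
    then show ?thesis by (simp add: case_prod_unfold)
  qed
  define r where "r = sqrt (real a * real b)"
  \<comment> \<open>This weight equalises the costs charged to the two ends of a pair: both become 1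
    / r.\<close>
  define \<kappa> where "\<kappa> = sqrt (real a / real b)"
  have \<kappa>: "\<kappa> > 0" using pos by (simp add: \<kappa>_def)
  have r: "r > 0" using pos by (simp add: r_def)
  have \<kappa>1: "\<kappa> / real a = 1 / r" "1 / (\<kappa> * real b) = 1 / r"
  proof -
    have "\<kappa> * r = real a" using pos by (simp add: \<kappa>_def r_def flip: real_sqrt_mult)
    then show "\<kappa> / real a = 1 / r" using pos r by (simp add: field_simps)
    have "\<kappa> * real b = r" using pos
      by (simp add: \<kappa>_def r_def real_sqrt_divide real_sqrt_mult field_simps)
    then show "1 / (\<kappa> * real b) = 1 / r" by simp
  qed

  define M where "M l \<beta> t = mass_on (query_basis {e \<in> E. lab e = l} m) (\<psi> \<beta> t)" for l \<beta> t
  \<comment> \<open>Every edge has one label, so different labels occupy disjoint parts of the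
    basis.\<close>
  have Msum: "(\<Sum>l\<in>L. M l \<beta> t) \<le> 1" if "t \<le> T" "finite L" for L \<beta> t
  proof -
    have "(\<Sum>l\<in>L. M l \<beta> t) = (\<Sum>i\<in>(\<Union>l\<in>L. query_basis {e \<in> E. lab e = l} m). (cmod (\<psi> \<beta> t i))\<^sup>2)"
      unfolding M_def mass_on_def using that finE
      by (subst sum.UNION_disjoint) (auto simp: query_basis_def)
    also have "\<dots> \<le> mass_on B (\<psi> \<beta> t)"
      unfolding mass_on_def using finB by (intro sum_mono2) (auto simp: query_basis_def B_def)
    finally show ?thesis using mass[OF that(1)] by simp
  qed
  have step: "W t \<le> W (Suc t) + 2 * card R / r" if "Suc t \<le> T" for t
  proof -
    have *: "cmod (inner_on B (\<psi> \<beta> t) (\<psi> (flip l \<beta>) t))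
      \<le> cmod (inner_on B (\<psi> \<beta> (Suc t)) (\<psi> (flip l \<beta>) (Suc t))) + (\<kappa> * M l \<beta> t + M l (flip l \<beta>) t / \<kappa>)"
      for \<beta> l
    proof -
      have "cmod (inner_on B (query (G \<beta>) (\<psi> \<beta> t)) (query (G (flip l \<beta>)) (\<psi> (flip l \<beta>) t))
              - inner_on B (\<psi> \<beta> t) (\<psi> (flip l \<beta>) t))
          \<le> \<kappa> * M l \<beta> t + M l (flip l \<beta>) t / \<kappa>"
        unfolding M_def using loc by (intro inner_on_query_change[OF finE \<kappa> _ _ B_def]) auto
      moreover have "inner_on B (\<psi> \<beta> (Suc t)) (\<psi> (flip l \<beta>) (Suc t))
          = inner_on B (query (G \<beta>) (\<psi> \<beta> t)) (query (G (flip l \<beta>)) (\<psi> (flip l \<beta>) t))"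
        using unB[OF that] finB by (simp add: psiS inner_on_apply_operator)
      ultimately show ?thesis by (smt (verit) norm_minus_commute norm_triangle_ineq2)
    qed
    have "W t \<le> (\<Sum>(\<beta>, l)\<in>R. cmod (inner_on B (\<psi> \<beta> (Suc t)) (\<psi> (flip l \<beta>) (Suc t)))
        + (\<kappa> * M l \<beta> t + M l (flip l \<beta>) t / \<kappa>))"
      unfolding W_def using * by (intro sum_mono) auto
    also have "\<dots> = W (Suc t) + \<kappa> * (\<Sum>(\<beta>, l)\<in>R. M l \<beta> t) + (\<Sum>(\<beta>, l)\<in>R. M l (flip l \<beta>) t) / \<kappa>"
      by (simp add: W_def case_prod_unfold sum.distrib sum_distrib_left sum_divide_distrib)
    also have "(\<Sum>(\<beta>, l)\<in>R. M l (flip l \<beta>) t) = (\<Sum>(\<beta>, l)\<in>R'. M l \<beta> t)"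
      by (rule sum.reindex_bij_witness[of _ "\<lambda>(\<beta>, l). (flip l \<beta>, l)" "\<lambda>(\<beta>, l). (flip l \<beta>, l)"])
         (auto simp: R_def R'_def)
    also have "(\<Sum>(\<beta>, l)\<in>R. M l \<beta> t) \<le> card X"
    proof -
      have "(\<Sum>(\<beta>, l)\<in>R. M l \<beta> t) = (\<Sum>\<beta>\<in>X. \<Sum>l | l \<in> \<Lambda> \<and> flip l \<beta> \<in> Y. M l \<beta> t)"
        unfolding R_def using finX fin\<Lambda> by (subst sum.Sigma) auto
      also have "\<dots> \<le> (\<Sum>\<beta>\<in>X. 1)" using that fin\<Lambda> by (intro sum_mono Msum) auto
      finally show ?thesis by simp
    qed
    also have "(\<Sum>(\<beta>, l)\<in>R'. M l \<beta> t) \<le> card Y"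
    proof -
      have "(\<Sum>(\<beta>, l)\<in>R'. M l \<beta> t) = (\<Sum>\<beta>\<in>Y. \<Sum>l | l \<in> \<Lambda> \<and> flip l \<beta> \<in> X. M l \<beta> t)"
        unfolding R'_def using finY fin\<Lambda> by (subst sum.Sigma) auto
      also have "\<dots> \<le> (\<Sum>\<beta>\<in>Y. 1)" using that fin\<Lambda> by (intro sum_mono Msum) auto
      finally show ?thesis by simp
    qed
    \<comment> \<open>The degree bounds convert numbers of inputs into numbers of pairs.\<close>
    also have "real (card X) \<le> card R / a" using Xa pos by (simp add: field_simps)
    also have "real (card Y) \<le> card R / b" using Yb pos by (simp add: field_simps)
    also have "W (Suc t) + \<kappa> * (card R / a) + card R / b / \<kappa>
        = W (Suc t) + card R * (\<kappa> / real a) + card R * (1 / (\<kappa> * real b))"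
      by (simp add: field_simps)
    also have "\<dots> = W (Suc t) + 2 * card R / r" unfolding \<kappa>1 by simp
    finally show ?thesis using \<kappa> by (simp add: divide_right_mono)
  qed
  have "W 0 \<le> W t + t * (2 * card R / r)" if "t \<le> T" for t
    using that
  proof (induction t)
    case (Suc t)
    then show ?case using step[of t] by (simp add: algebra_simps add_divide_distrib)
  qed simp
  from this[of T] have "card R \<le> card R * (17 / 18) + T * (2 * card R / r)"
    using W0 WT by simp
  then have "real (card R) * 1 \<le> card R * (17 / 18 + T * (2 / r))"
    by (simp add: algebra_simps)
  then have "1 \<le> 17 / 18 + T * (2 / r)" using R0 by (simp only: mult_le_cancel_left_pos)
  then have "r \<le> 36 * T" using r by (simp add: field_simps)
  then show ?thesis by (simp add: r_def)
qed

section \<open>An exact algorithm reading the whole input\<close>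

definition permutation_operator :: "('e \<times> bool \<times> nat \<Rightarrow> 'e \<times> bool \<times> nat) \<Rightarrow> 'e operator" where
  "permutation_operator p = (\<lambda>i j. if i = p j then 1 else 0)"

lemma unitary_on_permutation_operator:
  assumes "finite B" "inj_on p B" "p ` B \<subseteq> B"
  shows "unitary_on B (permutation_operator p)"
  unfolding unitary_on_def
proof (intro ballI)
  fix i j assume ij: "i \<in> B" "j \<in> B"
  have "(\<Sum>k\<in>B. cnj (permutation_operator p k i) * permutation_operator p k j)
      = (\<Sum>k\<in>B. if k = p i then (if p i = p j then 1 else 0) else 0)"
    by (intro sum.cong) (auto simp: permutation_operator_def)
  also have "\<dots> = (if p i = p j then 1 else 0)"
    using ij assms by (simp add: sum.delta image_subset_iff)
  also have "\<dots> = (if i = j then 1 else 0)"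
    using ij assms(2) by (auto dest: inj_onD)
  finally show "(\<Sum>k\<in>B. cnj (permutation_operator p k i) * permutation_operator p k j) = (if i = j then 1 else 0)" .
qed

lemma apply_permutation_operator:
  assumes "finite B" "s \<in> B"
  shows "apply_operator B (permutation_operator p) (basis_state s) = basis_state (p s)"
proof
  fix i
  have "apply_operator B (permutation_operator p) (basis_state s) i
      = (\<Sum>j\<in>B. if j = s then (if i = p s then 1 else 0) else 0)"
    unfolding apply_operator_def by (intro sum.cong) (auto simp: permutation_operator_def basis_state_def)
  also have "\<dots> = basis_state (p s) i"
    using assms by (simp add: sum.delta basis_state_def)
  finally show "apply_operator B (permutation_operator p) (basis_state s) i = basis_state (p s) i" .
qed

lemma query_basis_state: "query G (basis_state (e, b, w)) = basis_state (e, b \<noteq> (e \<in> G), w)"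
  by (rule ext) (auto simp: query_def basis_state_def split: if_splits)

text \<open>The work register stores the set of the edges found so far; each unitary swaps the answer bit
  with the (still zero) entry of the queried edge and moves on to the next edge.\<close>

theorem bounded_error_computable_card:
  fixes E :: "'e set"
  assumes "finite E" "E \<noteq> {}"
  shows "bounded_error_computable E g (card E)"
proof -
  define n where "n = card E"
  have n: "n > 0" using assms by (simp add: n_def card_gt_0_iff)
  obtain f where f: "bij_betw f {..<n} E"
    using ex_bij_betw_nat_finite[OF assms(1)] by (auto simp: n_def atLeast0LessThan)
  define m where "m = card (Pow E)"
  obtain k where k: "bij_betw k {..<m} (Pow E)"
    using ex_bij_betw_nat_finite[of "Pow E"] assms(1) by (auto simp: m_def atLeast0LessThan)
  define h where "h = the_inv_into {..<m} k"
  have h: "bij_betw h (Pow E) {..<m}" unfolding h_def by (rule bij_betw_the_inv_into[OF k])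
  have kh: "k (h S) = S" if "S \<subseteq> E" for S
    using that k unfolding h_def by (intro f_the_inv_into_f_bij_betw) auto
  define B where "B = query_basis E m"
  have finB: "finite B" using assms by (simp add: B_def finite_query_basis)
  have fE: "f (t mod n) \<in> E" for t using f n by (auto simp: bij_betw_def)
  \<comment> \<open>A transposition of edges and a swap of two bits keep \<open>p t\<close>
    injective on the whole basis, not only on the states that occur. The index modulo
    \<open>n\<close> gives the last unitary a next edge too.\<close>
  define p :: "nat \<Rightarrow> 'e \<times> bool \<times> nat \<Rightarrow> 'e \<times> bool \<times> nat" where "p t = (\<lambda>(e, b, w).
     (transpose (f (t mod n)) (f (Suc t mod n)) e, e \<in> k w, h (if b then insert e (k w) else k w - {e})))" for t
  \<comment> \<open>\<open>U 0\<close> acts before the first query and the start state already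
    points at \<open>f 0\<close>, hence the identity.\<close>
  define U where "U t = (if t = 0 then permutation_operator (\<lambda>i. i) else permutation_operator (p (t - 1)))" for t
  have hE: "h S < m" if "S \<subseteq> E" for S using that h by (auto simp: bij_betw_def)
  have kE: "k w \<subseteq> E" if "w < m" for w using that k by (auto simp: bij_betw_def)
  have unp: "unitary_on B (permutation_operator (p t))" for t
  proof (rule unitary_on_permutation_operator[OF finB])
    show "p t ` B \<subseteq> B"
    proof (rule image_subsetI)
      fix i assume "i \<in> B"
      then obtain e b w where i: "i = (e, b, w)" and e: "e \<in> E" and w: "w < m"
        by (auto simp: B_def query_basis_def)
      have "transpose (f (t mod n)) (f (Suc t mod n)) e \<in> E"
        using fE[of t] fE[of "Suc t"] e by (auto simp: transpose_def)
      moreover have "h (if b then insert e (k w) else k w - {e}) < m"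
        using e kE[OF w] by (intro hE) auto
      ultimately show "p t i \<in> B" by (simp add: i p_def B_def query_basis_def)
    qed
    show "inj_on (p t) B"
    proof (rule inj_onI)
      fix i j assume "i \<in> B" "j \<in> B" and pij: "p t i = p t j"
      then obtain e b w e' b' w' where ij: "i = (e, b, w)" "j = (e', b', w')"
        and e: "e \<in> E" and w: "w < m" "w' < m"
        by (auto simp: B_def query_basis_def)
      have e': "e' = e" using pij by (auto simp: ij p_def dest: injD[OF inj_transpose])
      \<comment> \<open>The image keeps everything: the second component is the old entry of
        \<open>e\<close>, and the new set holds the old answer bit at \<open>e\<close> and all other
        entries.\<close>
      have iff: "(e \<in> k w) = (e \<in> k w')"
        and eq: "h (if b then insert e (k w) else k w - {e}) = h (if b' then insert e (k w') else k w' - {e})"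
        using pij by (auto simp: ij e' p_def)
      have "(if b then insert e (k w) else k w - {e}) = (if b' then insert e (k w') else k w' - {e})"
        using h eq e kE[OF w(1)] kE[OF w(2)] by (intro inj_onD[of h "Pow E"]) (auto simp: bij_betw_def)
      then have "b = b'" and "k w = k w'" using iff by (auto split: if_splits)
      then show "i = j" using k w by (auto simp: ij e' bij_betw_def dest: inj_onD)
    qed
  qed
  have run: "run_query_algorithm B U (f 0, False, h {}) G t
      = basis_state (f (t mod n), False, h (G \<inter> f ` {..<t}))" if "t \<le> n" for G t
    using that
  proof (induction t)
    case 0
    have "(f 0, False, h {}) \<in> B" using fE[of 0] hE[of "{}"] by (simp add: B_def query_basis_def)
    then show ?case using finB by (simp add: U_def apply_permutation_operator)
  next
    case (Suc t)
    let ?S = "G \<inter> f ` {..<t}"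
    have S: "?S \<subseteq> E" using f Suc.prems by (auto simp: bij_betw_def)
    have t: "t mod n = t" using Suc.prems by simp
    \<comment> \<open>The entry of an unread edge is 0, so the swap resets the answer bit to
      \<open>False\<close> for the next query.\<close>
    have new: "f t \<notin> f ` {..<t}"
      using f Suc.prems by (auto simp: bij_betw_def dest!: inj_onD)
    have inB: "(f t, f t \<in> G, h ?S) \<in> B"
      using fE[of t] hE[OF S] by (simp add: B_def query_basis_def t)
    have "p t (f t, f t \<in> G, h ?S) = (f (Suc t mod n), False, h (G \<inter> f ` {..<Suc t}))"
      using new by (auto simp: p_def t kh[OF S] lessThan_Suc Int_insert_right)
    then show ?case using Suc inB finB
      by (simp add: t query_basis_state U_def apply_permutation_operator)
  qed
  define A where "A = {(e :: 'e, b :: bool, w). g (k w)}"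
  show ?thesis unfolding bounded_error_computable_def n_def[symmetric]
  proof (intro exI conjI allI impI)
    show "(f 0, False, h {}) \<in> query_basis E m"
      using fE[of 0] hE[of "{}"] by (simp add: query_basis_def)
    show "unitary_on (query_basis E m) (U t)" for t
      using unp unitary_on_permutation_operator[OF finB, of "\<lambda>i. i"] by (simp add: U_def B_def)
    fix G assume G: "G \<subseteq> E"
    define s where "s = (f (n mod n), False, h (G \<inter> f ` {..<n}))"
    have "f ` {..<n} = E" using f by (simp add: bij_betw_def)
    then have s: "s \<in> {i \<in> query_basis E m. i \<in> A \<longleftrightarrow> g G}"
      using fE[of n] hE[OF G] kh[OF G] G by (simp add: s_def query_basis_def A_def Int_absorb2)
    have "(2::real) / 3 \<le> (cmod (basis_state s s))\<^sup>2" by (simp add: basis_state_def)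
    also have "\<dots> \<le> (\<Sum>i\<in>{i \<in> query_basis E m. i \<in> A \<longleftrightarrow> g G}. (cmod (basis_state s i))\<^sup>2)"
      using finite_query_basis[OF assms(1)] by (intro member_le_sum[OF s]) auto
    finally show "(2::real) / 3 \<le> (\<Sum>i\<in>{i \<in> query_basis E m. i \<in> A \<longleftrightarrow> g G}.
        (cmod (run_query_algorithm (query_basis E m) U (f 0, False, h {}) G n i))\<^sup>2)"
      using run[of n G] by (simp add: B_def s_def)
  qed
qed

text \<open>\<open>LEAST\<close> is attained because some number of queries suffices; reading every
  edge provides one.\<close>

lemma bounded_error_computable_quantum_query_complexity:
  "finite E \<Longrightarrow> E \<noteq> {} \<Longrightarrow> bounded_error_computable E g (quantum_query_complexity E g)"
  unfolding quantum_query_complexity_def by (rule LeastI, rule bounded_error_computable_card)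

section \<open>Balanced words\<close>

abbreviation flip_at :: "nat \<Rightarrow> (nat \<Rightarrow> bool) \<Rightarrow> nat \<Rightarrow> bool" where
  "flip_at t w \<equiv> w(t := \<not> w t)"

definition ups :: "(nat \<Rightarrow> bool) \<Rightarrow> nat \<Rightarrow> nat" where
  "ups w t = card {i. i < t \<and> w i}"

lemma ups_0 [simp]: "ups w 0 = 0"
  by (simp add: ups_def)

lemma ups_Suc: "ups w (Suc t) = (if w t then Suc (ups w t) else ups w t)"
proof -
  have "{i. i < Suc t \<and> w i} = (if w t then insert t {i. i < t \<and> w i} else {i. i < t \<and> w i})"
    by (auto simp: less_Suc_eq)
  then show ?thesis by (simp add: ups_def)
qed

lemma ups_le: "ups w t \<le> t"
  by (induction t) (auto simp: ups_Suc)

lemma ups_mono: "t \<le> t' \<Longrightarrow> ups w t \<le> ups w t'"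
  unfolding ups_def by (intro card_mono) auto

lemma ups_pos: "w 0 \<Longrightarrow> 0 < t \<Longrightarrow> 0 < ups w t"
  using ups_mono[of "Suc 0" t w] by (simp add: ups_Suc)

text \<open>Up steps minus right steps: the displacement of the walk across the diagonal
  direction.\<close>

definition height :: "(nat \<Rightarrow> bool) \<Rightarrow> nat \<Rightarrow> int" where
  "height w t = 2 * int (ups w t) - int t"

lemma height_0 [simp]: "height w 0 = 0"
  by (simp add: height_def)

lemma height_Suc: "height w (Suc t) = height w t + (if w t then 1 else -1)"
  by (simp add: height_def ups_Suc)

lemma height_add: "height w (a + b) = height w a + height (\<lambda>t. w (a + t)) b"
  by (induction b) (simp_all add: height_Suc)

lemma height_mult: "height w (i * N) = (\<Sum>j<i. height (\<lambda>t. w (j * N + t)) N)"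
  by (induction i) (simp_all add: height_add add.commute[of N])

text \<open>A word of length \<open>(2 m + 1)^l\<close> is cut recursively into \<open>2 m + 1\<close> blocks. In a balanced word
  the numbers of blocks of value 1 and of value 0 differ by one at every level, so that every block
  has total height 1 or -1 according to its value.\<close>

primrec majority :: "nat \<Rightarrow> nat \<Rightarrow> (nat \<Rightarrow> bool) \<Rightarrow> bool" where
  "majority m 0 w = w 0"
| "majority m (Suc l) w =
     (card {i. i < 2 * m + 1 \<and> majority m l (\<lambda>t. w (i * (2 * m + 1) ^ l + t))} = m + 1)"

primrec balanced :: "nat \<Rightarrow> nat \<Rightarrow> (nat \<Rightarrow> bool) \<Rightarrow> bool" where
  "balanced m 0 w = True"
| "balanced m (Suc l) w =
     ((\<forall>i<2 * m + 1. balanced m l (\<lambda>t. w (i * (2 * m + 1) ^ l + t))) \<and>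
      card {i. i < 2 * m + 1 \<and> majority m l (\<lambda>t. w (i * (2 * m + 1) ^ l + t))} \<in> {m, m + 1})"

lemma block_index_less:
  assumes "i < k" "t < (N :: nat)"
  shows "i * N + t < k * N"
proof -
  have "i * N + t < Suc i * N" using assms by simp
  also have "\<dots> \<le> k * N" using assms by (intro mult_right_mono) auto
  finally show ?thesis .
qed

text \<open>Used to see that a flip inside one block does not affect the other blocks.\<close>

lemma majority_balanced_cong:
  assumes "\<And>t. t < (2 * m + 1) ^ l \<Longrightarrow> w t = w' t"
  shows "majority m l w = majority m l w'" "balanced m l w = balanced m l w'"
proof -
  have "majority m l w = majority m l w' \<and> balanced m l w = balanced m l w'"
    using assms
  proof (induction l arbitrary: w w')
    case (Suc l)
    have "w (i * (2 * m + 1) ^ l + t) = w' (i * (2 * m + 1) ^ l + t)"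
      if "i < 2 * m + 1" "t < (2 * m + 1) ^ l" for i t
      using block_index_less[OF that] by (intro Suc.prems) simp
    note IH = Suc.IH[OF this]
    have *: "majority m l (\<lambda>t. w (i * (2 * m + 1) ^ l + t)) = majority m l (\<lambda>t. w' (i * (2 * m + 1) ^ l + t))"
      "balanced m l (\<lambda>t. w (i * (2 * m + 1) ^ l + t)) = balanced m l (\<lambda>t. w' (i * (2 * m + 1) ^ l + t))"
      if "i < 2 * m + 1" for i
      by (rule IH[OF that, THEN conjunct1], assumption, rule IH[OF that, THEN conjunct2], assumption)
    then have "{i. i < 2 * m + 1 \<and> majority m l (\<lambda>t. w (i * (2 * m + 1) ^ l + t))}
        = {i. i < 2 * m + 1 \<and> majority m l (\<lambda>t. w' (i * (2 * m + 1) ^ l + t))}"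
      by blast
    then show ?case using * unfolding majority.simps balanced.simps by auto
  qed simp
  then show "majority m l w = majority m l w'" "balanced m l w = balanced m l w'" by auto
qed

lemma card_blocks_False:
  fixes m :: nat
  assumes "card {i. i < 2 * m + 1 \<and> P i} = c"
  shows "card {i. i < 2 * m + 1 \<and> \<not> P i} = 2 * m + 1 - c"
proof -
  let ?A = "{i. i < 2 * m + 1 \<and> P i}"
  have "{i. i < 2 * m + 1 \<and> \<not> P i} = {..<2 * m + 1} - ?A" by auto
  also have "card ({..<2 * m + 1} - ?A) = card {..<2 * m + 1} - card ?A"
    by (rule card_Diff_subset) auto
  finally show ?thesis unfolding assms card_lessThan .
qed

text \<open>Exactly \<open>m + 1\<close> of the blocks agree with the value of the whole word.
  Changing the value of one of them moves the count between \<open>m\<close> and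
  \<open>m + 1\<close>, so the word stays balanced and its value changes. By induction each of these
  blocks offers \<open>(m + 1) ^ l\<close> positions.\<close>

lemma balanced_flip_sensitivity:
  assumes "balanced m l w"
  shows "(m + 1) ^ l \<le> card {t. t < (2 * m + 1) ^ l \<and> balanced m l (flip_at t w) \<and>
     majority m l (flip_at t w) \<noteq> majority m l w}"
  using assms
proof (induction l arbitrary: w)
  case 0
  have "{t. t < (2 * m + 1) ^ 0 \<and> balanced m 0 (flip_at t w) \<and>
     majority m 0 (flip_at t w) \<noteq> majority m 0 w} = {0}" by auto
  then show ?case by simp
next
  case (Suc l)
  define N where "N = (2 * m + 1) ^ l"
  define bl where "bl w i = (\<lambda>t. w (i * N + t) :: bool)" for w i
  define V where "V w = {i. i < 2 * m + 1 \<and> majority m l (bl w i)}" for w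
  define P where "P = {i. i < 2 * m + 1 \<and> majority m l (bl w i) = majority m (Suc l) w}"
  define F where "F i = {t. t < N \<and> balanced m l (flip_at t (bl w i)) \<and>
     majority m l (flip_at t (bl w i)) \<noteq> majority m l (bl w i)}" for i
  have bal: "\<And>i. i < 2 * m + 1 \<Longrightarrow> balanced m l (bl w i)" and cV: "card (V w) \<in> {m, m + 1}"
    using Suc.prems unfolding bl_def N_def V_def by simp_all
  have maj: "majority m (Suc l) w' \<longleftrightarrow> card (V w') = m + 1" for w'
    unfolding V_def bl_def N_def by simp
  \<comment> \<open>For value 0 there are \<open>m\<close> blocks of value 1, which leaves
    \<open>m + 1\<close> blocks of value 0.\<close>
  have cP: "card P = m + 1"
  proof (cases "majority m (Suc l) w")
    case True
    then show ?thesis using maj[of w] unfolding P_def V_def by simp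
  next
    case False
    then have "card (V w) = m" using cV maj by auto
    then show ?thesis using False card_blocks_False[of m "\<lambda>i. majority m l (bl w i)" m]
      unfolding P_def V_def by simp
  qed
  have finF: "finite (F i)" for i unfolding F_def by simp
  have FN: "t < N" if "t \<in> F i" for i t using that by (simp add: F_def)
  have inj: "inj_on (\<lambda>(i, t). i * N + t) (Sigma P F)"
  proof (rule inj_on_inverseI[where g = "\<lambda>n. (n div N, n mod N)"])
    fix x assume "x \<in> Sigma P F"
    then obtain i t where x: "x = (i, t)" and "t \<in> F i" by blast
    then have "t < N" using FN by blast
    then show "(\<lambda>n. (n div N, n mod N)) ((\<lambda>(i, t). i * N + t) x) = x" by (simp add: x)
  qed
  have "(\<lambda>(i, t). i * N + t) ` Sigma P F
      \<subseteq> {t. t < (2 * m + 1) ^ Suc l \<and> balanced m (Suc l) (flip_at t w) \<and>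
         majority m (Suc l) (flip_at t w) \<noteq> majority m (Suc l) w}"
  proof (rule image_subsetI, clarify)
    fix i t assume i: "i \<in> P" and t: "t \<in> F i"
    let ?w = "flip_at (i * N + t) w"
    have i': "i < 2 * m + 1" using i by (simp add: P_def)
    have same: "bl ?w i = flip_at t (bl w i)" by (auto simp: bl_def fun_eq_iff)
    have other: "majority m l (bl ?w j) = majority m l (bl w j) \<and> balanced m l (bl ?w j) = balanced m l (bl w j)"
      if "j \<noteq> i" for j
    proof -
      have "bl ?w j s = bl w j s" if "s < N" for s
      proof -
        have "(j * N + s) div N = j" "(i * N + t) div N = i" using that FN[OF t] by simp_all
        then have "j * N + s \<noteq> i * N + t" using \<open>j \<noteq> i\<close> by metis
        then show ?thesis by (simp add: bl_def)
      qed
      then show ?thesis using majority_balanced_cong[of m l] unfolding N_def by blast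
    qed
    have majF: "majority m l (bl ?w i) \<noteq> majority m l (bl w i)" and balF: "balanced m l (bl ?w i)"
      using t unfolding F_def same by auto
    have memV: "j \<in> V ?w \<longleftrightarrow> (if j = i then \<not> majority m l (bl w i) else j \<in> V w)" for j
      using other[of j] majF i' unfolding V_def by (cases "j = i") simp_all
    have "card (V ?w) = (if majority m (Suc l) w then m else m + 1)"
    proof (cases "majority m (Suc l) w")
      case True
      then have mi: "majority m l (bl w i)" using i by (simp add: P_def)
      have "V ?w = V w - {i}" by (rule set_eqI) (simp add: memV mi)
      moreover have "i \<in> V w" using mi i' by (simp add: V_def)
      ultimately show ?thesis using True maj by simp
    next
      case False
      then have mi: "\<not> majority m l (bl w i)" using i by (simp add: P_def)
      have "V ?w = insert i (V w)" by (rule set_eqI) (simp add: memV mi)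
      moreover have "i \<notin> V w" "finite (V w)" using mi by (simp_all add: V_def)
      moreover have "card (V w) = m" using False cV maj by auto
      ultimately show ?thesis using False by simp
    qed
    moreover have "balanced m l (bl ?w j)" if "j < 2 * m + 1" for j
      using that other bal balF by (cases "j = i") auto
    ultimately have "balanced m (Suc l) ?w" "majority m (Suc l) ?w \<noteq> majority m (Suc l) w"
      using maj by (auto simp: V_def bl_def N_def)
    moreover have "i * N + t < (2 * m + 1) ^ Suc l"
      using block_index_less[OF i' FN[OF t]] by (simp add: N_def)
    ultimately show "i * N + t < (2 * m + 1) ^ Suc l \<and> balanced m (Suc l) ?w \<and>
         majority m (Suc l) ?w \<noteq> majority m (Suc l) w" by blast
  qed
  then have "card ((\<lambda>(i, t). i * N + t) ` Sigma P F)
      \<le> card {t. t < (2 * m + 1) ^ Suc l \<and> balanced m (Suc l) (flip_at t w) \<and>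
         majority m (Suc l) (flip_at t w) \<noteq> majority m (Suc l) w}"
    by (intro card_mono) auto
  moreover have "card P * (m + 1) ^ l \<le> card (Sigma P F)"
  proof (rule card_dependent_pairs_ge)
    show "finite P" by (simp add: P_def)
    fix i assume "i \<in> P"
    then show "(m + 1) ^ l \<le> card (F i)"
      using Suc.IH[of "bl w i"] bal unfolding F_def N_def P_def by blast
  qed (rule finF)
  ultimately show ?case unfolding cP power_Suc card_image[OF inj] by (rule order_trans[rotated])
qed

text \<open>Blocks count 1 or -1 by induction, and one value occurs exactly once more than the
  other, so all but one cancel.\<close>

lemma height_balanced:
  assumes "balanced m l w"
  shows "height w ((2 * m + 1) ^ l) = (if majority m l w then 1 else -1)"
  using assms
proof (induction l arbitrary: w)
  case 0
  then show ?case by (simp add: height_Suc)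
next
  case (Suc l)
  define v where "v i = majority m l (\<lambda>t. w (i * (2 * m + 1) ^ l + t))" for i
  define c where "c = card {i. i < 2 * m + 1 \<and> v i}"
  have c: "c \<in> {m, m + 1}" using Suc.prems by (simp add: c_def v_def)
  have "height w ((2 * m + 1) ^ Suc l) = (\<Sum>i<2 * m + 1. if v i then 1 else -1)"
    using Suc.IH Suc.prems unfolding v_def power_Suc height_mult by (intro sum.cong refl) simp
  also have "\<dots> = int (card {i. i < 2 * m + 1 \<and> v i}) - int (card {i. i < 2 * m + 1 \<and> \<not> v i})"
    by (subst sum.If_cases) (auto simp: Int_def)
  also have "\<dots> = int c - int (2 * m + 1 - c)"
    using card_blocks_False[of m v c] by (simp add: c_def)
  also have "\<dots> = (if majority m (Suc l) w then 1 else -1)"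
    using c by (auto simp: c_def v_def)
  finally show ?case .
qed

text \<open>Before \<open>t\<close> there are at most \<open>2 * m\<close> complete blocks, each of
  height 1 or -1, and then a part of one block, to which the induction applies. So each level adds
  \<open>2 * m\<close>, and the bound is logarithmic in the length.\<close>

lemma height_balanced_abs_le:
  assumes "balanced m l w" "t \<le> (2 * m + 1) ^ l"
  shows "\<bar>height w t\<bar> \<le> 2 * int m * int l + 1"
  using assms
proof (induction l arbitrary: w t)
  case 0
  then have "t = 0 \<or> t = 1" by auto
  then show ?case by (auto simp: height_Suc)
next
  case (Suc l)
  define N where "N = (2 * m + 1) ^ l"
  have N: "N > 0" by (simp add: N_def)
  show ?case
  proof (cases "t = (2 * m + 1) ^ Suc l")
    case True
    then show ?thesis using height_balanced[OF Suc.prems(1)] by auto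
  next
    case False
    define i where "i = t div N"
    define r where "r = t mod N"
    have "t < (2 * m + 1) * N" using False Suc.prems(2) by (simp add: N_def)
    then have i: "i < 2 * m + 1" using N by (simp add: i_def less_mult_imp_div_less)
    have t: "t = i * N + r" by (simp add: i_def r_def)
    have bal: "balanced m l (\<lambda>t. w (j * N + t))" if "j < 2 * m + 1" for j
      using Suc.prems that by (simp add: N_def)
    have "\<bar>height w (i * N)\<bar> \<le> (\<Sum>j<i. \<bar>height (\<lambda>t. w (j * N + t)) N\<bar>)"
      unfolding height_mult by (rule sum_abs)
    also have "\<dots> = (\<Sum>j<i. 1)"
      using height_balanced[OF bal] i unfolding N_def by (intro sum.cong refl) simp
    also have "\<dots> \<le> 2 * int m" using i by simp
    finally have "\<bar>height w (i * N)\<bar> \<le> 2 * int m" .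
    moreover have "r \<le> N" using N by (simp add: r_def order_less_imp_le)
    then have "\<bar>height (\<lambda>t. w (i * N + t)) r\<bar> \<le> 2 * int m * int l + 1"
      using Suc.IH[OF bal[OF i]] by (simp add: N_def)
    ultimately show ?thesis unfolding t height_add by (simp add: algebra_simps)
  qed
qed

text \<open>Blocks of value 1 come first, followed by blocks of value 0. This will supply a
  0-input.\<close>

lemma balanced_exists: "\<exists>w. balanced m l w \<and> majority m l w = v"
proof (induction l arbitrary: v)
  case 0
  show ?case by (rule exI[of _ "\<lambda>_. v"]) simp
next
  case (Suc l)
  obtain W where W: "\<And>v. balanced m l (W v)" "\<And>v. majority m l (W v) = v"
    using Suc.IH by metis
  define N where "N = (2 * m + 1) ^ l"
  define c where "c = (if v then m + 1 else m)"
  define w where "w t = W (t div N < c) (t mod N)" for t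
  have "w (i * N + t) = W (i < c) t" if "t < N" for i t using that by (simp add: w_def)
  then have *: "balanced m l (\<lambda>t. w (i * N + t))" "majority m l (\<lambda>t. w (i * N + t)) = (i < c)" for i
    using majority_balanced_cong[of m l "\<lambda>t. w (i * N + t)" "W (i < c)"] W unfolding N_def by simp_all
  have "{i. i < 2 * m + 1 \<and> i < c} = {..<c}" by (auto simp: c_def)
  then have "card {i. i < 2 * m + 1 \<and> majority m l (\<lambda>t. w (i * N + t))} = c" by (simp add: *)
  then have "balanced m (Suc l) w \<and> majority m (Suc l) w = v"
    using *(1) unfolding N_def by (simp add: c_def)
  then show ?case by blast
qed

section \<open>Families of walks\<close>

text \<open>The first bit of a word opens its walk: a word in \<open>D\<close> whose first bit is 0 has no walk at all, so
  that nothing is required of its heights.\<close>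

locale walk_family =
  fixes L H Y s :: nat and D U :: "(nat \<Rightarrow> bool) \<Rightarrow> bool"
  assumes D_flips: "D w \<Longrightarrow> s \<le> card {t. t < L \<and> U (flip_at t w)}"
    and U_flips: "U w \<Longrightarrow> s \<le> card {t. t < L \<and> D (flip_at t w)}"
    and D_range: "D w \<Longrightarrow> w 0 \<Longrightarrow> t \<le> L \<Longrightarrow> \<bar>height w t\<bar> \<le> int H"
    and D_ups: "D w \<Longrightarrow> w 0 \<Longrightarrow> ups w L < Y"
    and U_start: "U w \<Longrightarrow> w 0"
    and U_range: "U w \<Longrightarrow> t < L \<Longrightarrow> \<bar>height w t\<bar> \<le> int H"
    and U_ups: "U w \<Longrightarrow> ups w L = Y"
    and D_exists: "\<exists>w. D w \<and> (\<forall>t\<ge>L. \<not> w t)"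
    and L_pos: "0 < L" and Y_pos: "0 < Y" and s_pos: "0 < s"

text \<open>The degenerate family with strips of width 1: a single bit opens or blocks one step up.
  It serves grids whose second largest side is bounded.\<close>

lemma walk_family_single: "walk_family 1 0 1 1 (\<lambda>w. \<not> w 0) (\<lambda>w. w 0)"
proof
  have single: "card {t::nat. t < 1 \<and> P t} = 1" if "P 0" for P
  proof -
    have "{t. t < 1 \<and> P t} = {0}" using that by auto
    then show ?thesis by simp
  qed
  show "1 \<le> card {t. t < 1 \<and> flip_at t w 0}" if "\<not> w 0" for w :: "nat \<Rightarrow> bool"
    by (subst single) (use that in auto)
  show "1 \<le> card {t. t < 1 \<and> \<not> flip_at t w 0}" if "w 0" for w :: "nat \<Rightarrow> bool"
    by (subst single) (use that in auto)
  show "\<exists>w::nat \<Rightarrow> bool. \<not> w 0 \<and> (\<forall>t\<ge>1. \<not> w t)" by (rule exI[of _ "\<lambda>_. False"]) simp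
qed (auto simp: ups_Suc)

lemma ups_shift: "w 0 \<Longrightarrow> ups w (Suc t) = Suc (ups (\<lambda>t. w (Suc t)) t)"
  by (induction t) (simp_all add: ups_Suc)

lemma height_shift: "w 0 \<Longrightarrow> height w (Suc t) = 1 + height (\<lambda>t. w (Suc t)) t"
  by (simp add: height_def ups_shift)

text \<open>A constant first bit 1 lifts the walk off the row \<open>y = 0\<close>; a balanced word
  follows. That step adds 1 to the height bound, and the two values of the word end exactly one up
  step apart.\<close>

lemma walk_family_balanced:
  fixes m l :: nat
  defines "N \<equiv> (2 * m + 1) ^ l"
  defines "F \<equiv> \<lambda>v w. w 0 \<and> balanced m l (\<lambda>t. w (Suc t)) \<and> majority m l (\<lambda>t. w (Suc t)) = v"
  shows "walk_family (N + 1) (2 * m * l + 2) (Suc ((N + 1) div 2)) ((m + 1) ^ l) (F False) (F True)"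
proof
  have flips: "(m + 1) ^ l \<le> card {t. t < N + 1 \<and> F (\<not> v) (flip_at t w)}" if w: "F v w" for v w
  proof -
    let ?w = "\<lambda>t. w (Suc t)"
    let ?S = "{t. t < N \<and> balanced m l (flip_at t ?w) \<and> majority m l (flip_at t ?w) \<noteq> majority m l ?w}"
    have eq: "(\<lambda>s. (flip_at (Suc t) w) (Suc s)) = flip_at t ?w" for t by auto
    have iff: "F v' (flip_at (Suc t) w) \<longleftrightarrow>
        w 0 \<and> balanced m l (flip_at t ?w) \<and> majority m l (flip_at t ?w) = v'" for v' t
      unfolding F_def eq by simp
    have "w 0" and v: "majority m l ?w = v" using w by (simp_all add: F_def)
    then have "Suc ` ?S \<subseteq> {t. t < N + 1 \<and> F (\<not> v) (flip_at t w)}"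
      unfolding v image_subset_iff mem_Collect_eq iff by simp
    then have "card (Suc ` ?S) \<le> card {t. t < N + 1 \<and> F (\<not> v) (flip_at t w)}"
      by (rule card_mono[rotated]) (rule finite_subset[of _ "{..N}"], auto)
    moreover have "(m + 1) ^ l \<le> card ?S"
      using balanced_flip_sensitivity[of m l ?w] w unfolding F_def N_def by blast
    moreover have "card (Suc ` ?S) = card ?S" by (rule card_image) simp
    ultimately show ?thesis by linarith
  qed
  show "(m + 1) ^ l \<le> card {t. t < N + 1 \<and> F True (flip_at t w)}" if "F False w" for w
    using flips[OF that] by simp
  show "(m + 1) ^ l \<le> card {t. t < N + 1 \<and> F False (flip_at t w)}" if "F True w" for w
    using flips[OF that] by simp
  have range: "\<bar>height w t\<bar> \<le> int (2 * m * l + 2)" if w: "F v w" and t: "t \<le> N + 1" for v w t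
  proof (cases t)
    case (Suc r)
    then have "\<bar>height (\<lambda>t. w (Suc t)) r\<bar> \<le> 2 * int m * int l + 1"
      using w t unfolding F_def N_def by (intro height_balanced_abs_le) auto
    then show ?thesis using w Suc unfolding F_def by (simp add: height_shift)
  qed simp
  show "\<bar>height w t\<bar> \<le> int (2 * m * l + 2)" if "F False w" "w 0" "t \<le> N + 1" for w t
    using range that by blast
  show "\<bar>height w t\<bar> \<le> int (2 * m * l + 2)" if "F True w" "t < N + 1" for w t
    using range that by (meson less_imp_le)
  have "odd N" by (simp add: N_def)
  then have half: "2 * ((N + 1) div 2) = N + 1" by simp
  \<comment> \<open>One initial up step plus (N + 1) / 2 or (N - 1) / 2 further ones, depending on
    the value.\<close>
  have total: "2 * int (ups w (N + 1)) = int N + (if v then 3 else 1)" if "F v w" for v w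
  proof -
    have "height (\<lambda>t. w (Suc t)) N = (if v then 1 else -1)"
      using that height_balanced[of m l "\<lambda>t. w (Suc t)"] unfolding F_def N_def by blast
    moreover have "ups w (N + 1) = Suc (ups (\<lambda>t. w (Suc t)) N)"
      using that ups_shift[of w N] by (simp add: F_def)
    ultimately show ?thesis by (simp add: height_def split: if_splits)
  qed
  show "ups w (N + 1) < Suc ((N + 1) div 2)" if "F False w" "w 0" for w
    using total[OF that(1)] half unfolding if_False by linarith
  show "ups w (N + 1) = Suc ((N + 1) div 2)" if "F True w" for w
    using total[OF that] half unfolding if_True by linarith
  obtain w where w: "balanced m l w" "\<not> majority m l w" using balanced_exists[of m l False] by auto
  \<comment> \<open>Padded by 0 so that the set of its 1-positions stays below the length of the
    walk.\<close>
  define w' where "w' t = (if t = 0 then True else if t \<le> N then w (t - 1) else False)" for t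
  have "F False w'"
  proof -
    have "w' (Suc t) = w t" if "t < (2 * m + 1) ^ l" for t using that by (simp add: w'_def N_def)
    note majority_balanced_cong[of m l "\<lambda>t. w' (Suc t)" w, OF this]
    moreover have "w' 0" by (simp add: w'_def)
    ultimately show ?thesis using w unfolding F_def by blast
  qed
  moreover have "\<forall>t\<ge>N + 1. \<not> w' t" by (simp add: w'_def)
  ultimately show "\<exists>w. F False w \<and> (\<forall>t\<ge>N + 1. \<not> w t)" by blast
  show "w 0" if "F True w" for w using that by (simp add: F_def)
  show "0 < N + 1" by simp
  show "0 < Suc ((N + 1) div 2)" by simp
  show "0 < (m + 1) ^ l" by simp
qed

section \<open>Strips in the grid\<close>

lemma grid_vertices_Nil: "grid_vertices [] = {[]}"
  by (auto simp: grid_vertices_def)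

lemma Cons_mem_grid_vertices: "x # v \<in> grid_vertices (n # ns) \<longleftrightarrow> x \<le> n \<and> v \<in> grid_vertices ns"
  by (auto simp: grid_vertices_def All_less_Suc2)

lemma grid_vertices_Cons: "grid_vertices (n # ns) = (\<lambda>(x, v). x # v) ` ({..n} \<times> grid_vertices ns)"
proof (intro equalityI subsetI)
  fix u assume u: "u \<in> grid_vertices (n # ns)"
  then obtain x v where "u = x # v" by (cases u) (auto simp: grid_vertices_def)
  then show "u \<in> (\<lambda>(x, v). x # v) ` ({..n} \<times> grid_vertices ns)"
    using u by (auto simp: Cons_mem_grid_vertices)
qed (auto simp: Cons_mem_grid_vertices)

lemma finite_grid_vertices: "finite (grid_vertices ns)"
  by (induction ns) (auto simp: grid_vertices_Nil grid_vertices_Cons)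

lemma prod_list_le_card_grid_vertices: "prod_list ns \<le> card (grid_vertices ns)"
proof (induction ns)
  case (Cons n ns)
  have "card (grid_vertices (n # ns)) = Suc n * card (grid_vertices ns)"
    unfolding grid_vertices_Cons
    by (subst card_image) (auto simp: inj_on_def card_cartesian_product)
  then show ?case using mult_le_mono[OF le_SucI[OF order_refl[of n]] Cons.IH] by simp
qed (simp add: grid_vertices_Nil)

lemma finite_grid_edges: "finite (grid_edges ns)"
  by (rule finite_subset[of _ "grid_vertices ns \<times> grid_vertices ns"])
     (auto simp: grid_edges_def finite_grid_vertices)

lemma grid_edges_nonempty:
  assumes "ns \<noteq> []" "\<forall>n\<in>set ns. n \<ge> 1"
  shows "grid_edges ns \<noteq> {}"
proof -
  let ?u = "replicate (length ns) 0"
  have "(?u, ?u[0 := ?u ! 0 + 1]) \<in> grid_edges ns"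
    using assms by (auto simp: grid_edges_def grid_vertices_def nth_list_update)
  then show ?thesis by blast
qed

lemma grid_vertices_update:
  assumes "u \<in> grid_vertices ns" "i < length ns" "a \<le> ns ! i"
  shows "u[i := a] \<in> grid_vertices ns"
  using assms by (auto simp: grid_vertices_def nth_list_update)

text \<open>Raise any coordinate that is still too small; the total distance decreases. The path is
  confined to the box between its ends so that it can later be placed in the regions where all edges
  are present.\<close>

lemma monotone_grid_path:
  assumes "u \<in> grid_vertices ns" "v \<in> grid_vertices ns" "\<And>i. i < length ns \<Longrightarrow> u ! i \<le> v ! i"
  shows "(u, v) \<in> {(a, b) \<in> grid_edges ns. \<forall>i<length ns. u ! i \<le> a ! i \<and> b ! i \<le> v ! i}\<^sup>*"
  using assms
proof (induction "\<Sum>i<length ns. v ! i - u ! i" arbitrary: u rule: less_induct)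
  case less
  let ?R = "\<lambda>u. {(a, b) \<in> grid_edges ns. \<forall>i<length ns. u ! i \<le> a ! i \<and> b ! i \<le> v ! i}"
  have len: "length u = length ns" "length v = length ns"
    using less.prems by (auto simp: grid_vertices_def)
  show ?case
  proof (cases "u = v")
    case False
    then obtain i where i: "i < length ns" "u ! i < v ! i"
      using less.prems(3) len by (metis le_neq_implies_less nth_equalityI)
    define u' where "u' = u[i := u ! i + 1]"
    have u'_nth: "u' ! j = (if j = i then u ! i + 1 else u ! j)" if "j < length ns" for j
      using that len by (simp add: u'_def)
    have "v ! i \<le> ns ! i" using less.prems(2) i by (simp add: grid_vertices_def)
    then have u': "u' \<in> grid_vertices ns"
      unfolding u'_def using less.prems(1) i by (intro grid_vertices_update) auto
    have le: "u' ! j \<le> v ! j" if "j < length ns" for j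
      using that less.prems(3) i by (simp add: u'_nth)
    have "(\<Sum>j<length ns. v ! j - u' ! j) < (\<Sum>j<length ns. v ! j - u ! j)"
      by (rule sum_strict_mono_strong[of _ i]) (use i in \<open>auto simp: u'_nth\<close>)
    then have "(u', v) \<in> (?R u')\<^sup>*" using less.hyps u' less.prems(2) le by blast
    moreover have "?R u' \<subseteq> ?R u"
    proof (clarify)
      fix a b j assume "\<forall>j<length ns. u' ! j \<le> a ! j \<and> b ! j \<le> v ! j" "j < length ns"
      then show "u ! j \<le> a ! j \<and> b ! j \<le> v ! j"
        using u'_nth[of j] by (metis Suc_eq_plus1 Suc_leD)
    qed
    ultimately have "(u', v) \<in> (?R u)\<^sup>*" using rtrancl_mono by blast
    moreover have "(u, u') \<in> ?R u"
      using less.prems(1) u' i(1) le by (auto simp: grid_edges_def u'_def)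
    ultimately show ?thesis by (meson converse_rtrancl_into_rtrancl)
  qed simp
qed

section \<open>Strips, labels and the encoding of hidden bits\<close>

text \<open>The last two coordinates of a vertex are called \<open>y\<close> (bounded by \<open>n\<close>) and \<open>x\<close> (bounded by \<open>q\<close>).
  For every value of the other coordinates there are \<open>J\<close> parallel strips of width \<open>W\<close> along the
  diagonals \<open>x - y = const\<close>. All edges with \<open>y = 0\<close> and all edges with \<open>y \<ge> Y\<close> are present; in
  between, the strip of a vertex and its distance from the starting point of the strip determine
  the bit which selects one of the two outgoing edges.\<close>

locale strip_grid = walk_family +
  fixes zs :: "nat list" and n q J :: nat
  assumes Y_le: "Y \<le> n" and fits: "J * (2 * H + 1) + L \<le> q + 1" and J_pos: "0 < J"
begin

definition k :: nat where "k = length zs"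
definition W :: nat where "W = 2 * H + 1"
definition ns :: "nat list" where "ns = zs @ [n, q]"

definition strips :: "(nat list \<times> nat) set" where
  "strips = grid_vertices zs \<times> {..<J}"

text \<open>Strip \<open>j\<close> consists of the diagonals with \<open>x - y\<close> from
  \<open>j * W\<close> to \<open>j * W + 2 * H\<close>. Truncated subtraction sends
  \<open>x < y\<close> to strip 0, but walks of height at most \<open>H\<close> never go
  there.\<close>

definition strip_of :: "nat list \<Rightarrow> nat list \<times> nat" where
  "strip_of u = (take k u, (u ! Suc k - u ! k) div W)"

text \<open>The middle diagonal of the strip, with \<open>H\<close> diagonals on either
  side.\<close>

definition start_column :: "nat \<Rightarrow> nat" where
  "start_column j = j * W + H"

text \<open>Every step raises \<open>x + y\<close> by 1, so this counts the steps since the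
  start.\<close>

definition time_of :: "nat list \<Rightarrow> nat" where
  "time_of u = u ! k + u ! Suc k - start_column (snd (strip_of u))"

definition lab :: "nat list \<times> nat list \<Rightarrow> (nat list \<times> nat) \<times> nat" where
  "lab e = (strip_of (fst e), time_of (fst e))"

definition labels :: "((nat list \<times> nat) \<times> nat) set" where
  "labels = strips \<times> {..<L}"

text \<open>The row \<open>y = 0\<close> can be traversed freely, so the start column condition is
  needed to stop paths from entering a strip elsewhere than at the beginning of its walk.\<close>

definition G :: "((nat list \<times> nat) \<times> nat) set \<Rightarrow> (nat list \<times> nat list) set" where
  "G \<beta> = {(u, v) \<in> grid_edges ns.
     u ! k = 0 \<and> v ! k = 0 \<or> Y \<le> u ! k \<or>
     lab (u, v) \<in> labels \<and> lab (u, v) \<in> \<beta> \<and> v = u[k := u ! k + 1] \<and>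
       (u ! k = 0 \<longrightarrow> u ! Suc k = start_column (snd (strip_of u))) \<or>
     lab (u, v) \<in> labels \<and> lab (u, v) \<notin> \<beta> \<and> v = u[Suc k := u ! Suc k + 1] \<and> 0 < u ! k}"

definition word :: "((nat list \<times> nat) \<times> nat) set \<Rightarrow> nat list \<times> nat \<Rightarrow> nat \<Rightarrow> bool" where
  "word \<beta> i t \<longleftrightarrow> (i, t) \<in> \<beta>"

definition pos :: "(nat \<Rightarrow> bool) \<Rightarrow> nat list \<times> nat \<Rightarrow> nat \<Rightarrow> nat list" where
  "pos w i t = fst i @ [ups w t, start_column (snd i) + t - ups w t]"

lemma length_ns: "length ns = Suc (Suc k)"
  by (simp add: ns_def k_def)

lemma ns_nth: "ns ! k = n" "ns ! Suc k = q"
  by (simp_all add: ns_def k_def nth_append)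

lemma mem_grid_vertices_ns:
  "z @ [y, x] \<in> grid_vertices ns" if "z \<in> grid_vertices zs" "y \<le> n" "x \<le> q"
  using that unfolding ns_def grid_vertices_def
  by (auto simp: nth_append less_Suc_eq nth_Cons')

lemma grid_vertices_ns_cases:
  assumes "u \<in> grid_vertices ns"
  obtains z y x where "u = z @ [y, x]" "z \<in> grid_vertices zs" "y \<le> n" "x \<le> q"
proof -
  have len: "length u = Suc (Suc k)" using assms by (simp add: grid_vertices_def length_ns)
  have le: "u ! i \<le> ns ! i" if "i < Suc (Suc k)" for i
    using assms that by (simp add: grid_vertices_def length_ns)
  have "u = take k u @ [u ! k, u ! Suc k]"
    using len by (metis append_take_drop_id Cons_nth_drop_Suc drop_all le_refl lessI less_SucI)
  moreover have "take k u \<in> grid_vertices zs"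
    using len le by (auto simp: grid_vertices_def k_def ns_def nth_append) (metis less_SucI)
  ultimately show ?thesis using that le[of k] le[of "Suc k"] ns_nth by simp
qed

lemma strips_fst: "i \<in> strips \<Longrightarrow> fst i \<in> grid_vertices zs"
  and strips_length: "i \<in> strips \<Longrightarrow> length (fst i) = k"
  and strips_snd: "i \<in> strips \<Longrightarrow> snd i < J"
  by (auto simp: strips_def grid_vertices_def k_def)

lemma pos_nth:
  assumes "i \<in> strips"
  shows "take k (pos w i t) = fst i" "pos w i t ! k = ups w t"
    "pos w i t ! Suc k = start_column (snd i) + t - ups w t"
  using strips_length[OF assms] by (simp_all add: pos_def nth_append)

lemma pos_Suc:
  assumes "i \<in> strips"
  shows "w t \<Longrightarrow> pos w i (Suc t) = (pos w i t)[k := pos w i t ! k + 1]"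
    "\<not> w t \<Longrightarrow> pos w i (Suc t) = (pos w i t)[Suc k := pos w i t ! Suc k + 1]"
  using strips_length[OF assms] ups_le[of w t]
  by (auto simp: pos_def list_update_append nth_append ups_Suc Suc_diff_le)

text \<open>On the walk, \<open>x - y\<close> equals \<open>snd i * W + (H - height w t)\<close>,
  and the last summand lies between 0 and \<open>2 * H < W\<close>.\<close>

lemma lookup_pos:
  assumes i: "i \<in> strips" and h: "\<bar>height w t\<bar> \<le> int H"
  shows "strip_of (pos w i t) = i" "time_of (pos w i t) = t"
proof -
  have y: "2 * ups w t \<le> t + H" "t \<le> 2 * ups w t + H"
    using h by (simp_all add: height_def)
  have "start_column (snd i) + t - ups w t - ups w t = (H + t - 2 * ups w t) + snd i * W"
    using y by (simp add: start_column_def)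
  moreover have "H + t - 2 * ups w t < W" using y by (simp add: W_def)
  ultimately have "(start_column (snd i) + t - ups w t - ups w t) div W = snd i" by simp
  then show s: "strip_of (pos w i t) = i"
    by (simp add: strip_of_def pos_nth[OF i])
  show "time_of (pos w i t) = t"
    using ups_le[of w t] by (simp add: time_of_def s pos_nth[OF i])
qed

lemma G_free_bottom: "(u, v) \<in> grid_edges ns \<Longrightarrow> u ! k = 0 \<Longrightarrow> v ! k = 0 \<Longrightarrow> (u, v) \<in> G \<beta>"
  and G_free_top: "(u, v) \<in> grid_edges ns \<Longrightarrow> Y \<le> u ! k \<Longrightarrow> (u, v) \<in> G \<beta>"
  by (simp_all add: G_def)

lemma G_local: "lab e \<noteq> l \<Longrightarrow> e \<in> G (flip l \<beta>) \<longleftrightarrow> e \<in> G \<beta>"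
  by (cases e) (simp add: G_def mem_flip_iff)

lemma start_column_less: "j < J \<Longrightarrow> start_column j < J * W"
  unfolding start_column_def by (rule block_index_less) (auto simp: W_def)

section \<open>Connectivity in terms of the words\<close>

lemma pos_mem_grid_vertices:
  assumes i: "i \<in> strips" and U: "U w" and t: "t \<le> L"
  shows "pos w i t \<in> grid_vertices ns"
proof -
  have "ups w t \<le> n" using ups_mono[OF t, of w] U_ups[OF U] Y_le by simp
  moreover have "start_column (snd i) + t - ups w t \<le> q"
    using start_column_less[OF strips_snd[OF i]] fits ups_pos[of w t] U_start[OF U] t
    by (cases t) (auto simp: W_def)
  ultimately show ?thesis using strips_fst[OF i] unfolding pos_def by (intro mem_grid_vertices_ns)
qed

text \<open>Three legs: free edges in the region \<open>y = 0\<close> to the start of the strip, the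
  walk of its word up to \<open>y = Y\<close>, and free edges above.\<close>

lemma connected_if_up:
  assumes i: "i \<in> strips" and U: "U (word \<beta> i)"
  shows "DConnectivity ns (G \<beta>)"
proof -
  define w where "w = word \<beta> i"
  let ?s = "replicate (length ns) 0"
  have Uw: "U w" using U by (simp add: w_def)
  have "(?s, pos w i t) \<in> (G \<beta>)\<^sup>*" if "t \<le> L" for t
    using that
  proof (induction t)
    case 0
    have "(?s, pos w i 0) \<in> {(a, b) \<in> grid_edges ns.
        \<forall>j<length ns. ?s ! j \<le> a ! j \<and> b ! j \<le> pos w i 0 ! j}\<^sup>*"
      using pos_mem_grid_vertices[OF i Uw, of 0]
      by (intro monotone_grid_path) (auto simp: grid_vertices_def)
    moreover have "{(a, b) \<in> grid_edges ns.
        \<forall>j<length ns. ?s ! j \<le> a ! j \<and> b ! j \<le> pos w i 0 ! j} \<subseteq> G \<beta>"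
    proof clarify
      fix a b assume e: "(a, b) \<in> grid_edges ns"
        and le: "\<forall>j<length ns. ?s ! j \<le> a ! j \<and> b ! j \<le> pos w i 0 ! j"
      have "b ! k = 0" using le[rule_format, of k] pos_nth(2)[OF i, of w 0] by (simp add: length_ns)
      moreover have "a ! k \<le> b ! k"
        using e length_ns by (auto simp: grid_edges_def grid_vertices_def nth_list_update)
      ultimately show "(a, b) \<in> G \<beta>" using G_free_bottom[OF e] by simp
    qed
    ultimately show ?case using rtrancl_mono by blast
  next
    case (Suc t)
    then have t: "t < L" by simp
    have look: "lab (pos w i t, v) = (i, t)" for v
      using lookup_pos[OF i U_range[OF Uw t]] by (simp add: lab_def)
    have lbl: "(i, t) \<in> labels" using i t by (simp add: labels_def)
    have verts: "pos w i t \<in> grid_vertices ns" "pos w i (Suc t) \<in> grid_vertices ns"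
      using pos_mem_grid_vertices[OF i Uw] t by simp_all
    have "(pos w i t, pos w i (Suc t)) \<in> G \<beta>"
    proof (cases "w t")
      case True
      have "(i, t) \<in> \<beta>" using True by (simp add: w_def word_def)
      \<comment> \<open>The first bit is 1, so \<open>y = 0\<close> holds only at time 0, at the
        start column.\<close>
      moreover have "pos w i t ! Suc k = start_column (snd (strip_of (pos w i t)))" if "pos w i t ! k = 0"
      proof -
        have "t = 0" using that ups_pos[of w t] U_start[OF Uw] by (auto simp: pos_nth[OF i])
        then show ?thesis using lookup_pos(1)[OF i U_range[OF Uw t]] by (simp add: pos_nth[OF i])
      qed
      moreover have "(pos w i t, pos w i (Suc t)) \<in> grid_edges ns"
        using verts pos_Suc(1)[of i w t, OF i True] length_ns
        unfolding grid_edges_def by (auto intro!: exI[of _ k])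
      ultimately show ?thesis
        using pos_Suc(1)[of i w t, OF i True] look lbl unfolding G_def by simp
    next
      case False
      have "(i, t) \<notin> \<beta>" using False by (simp add: w_def word_def)
      moreover have "0 < pos w i t ! k"
        using False ups_pos[of w t] U_start[OF Uw] by (cases t) (auto simp: pos_nth[OF i])
      moreover have "(pos w i t, pos w i (Suc t)) \<in> grid_edges ns"
        using verts pos_Suc(2)[of i w t, OF i False] length_ns
        unfolding grid_edges_def by (auto intro!: exI[of _ "Suc k"])
      ultimately show ?thesis
        using pos_Suc(2)[of i w t, OF i False] look lbl unfolding G_def by simp
    qed
    then show ?case using Suc by (meson Suc_leD rtrancl.rtrancl_into_rtrancl)
  qed
  then have "(?s, pos w i L) \<in> (G \<beta>)\<^sup>*" by simp
  moreover have "(pos w i L, ns) \<in> (G \<beta>)\<^sup>*"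
  proof -
    have "(pos w i L, ns) \<in> {(a, b) \<in> grid_edges ns.
        \<forall>j<length ns. pos w i L ! j \<le> a ! j \<and> b ! j \<le> ns ! j}\<^sup>*"
      using pos_mem_grid_vertices[OF i Uw, of L]
      by (intro monotone_grid_path) (auto simp: grid_vertices_def)
    moreover have "{(a, b) \<in> grid_edges ns.
        \<forall>j<length ns. pos w i L ! j \<le> a ! j \<and> b ! j \<le> ns ! j} \<subseteq> G \<beta>"
    proof clarify
      fix a b assume e: "(a, b) \<in> grid_edges ns"
        and le: "\<forall>j<length ns. pos w i L ! j \<le> a ! j \<and> b ! j \<le> ns ! j"
      have "Y \<le> a ! k"
        using le[rule_format, of k] U_ups[OF Uw] by (simp add: length_ns pos_nth(2)[OF i])
      then show "(a, b) \<in> G \<beta>" by (rule G_free_top[OF e])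
    qed
    ultimately show ?thesis using rtrancl_mono by blast
  qed
  ultimately show ?thesis unfolding DConnectivity_def by (rule rtrancl_trans)
qed

text \<open>The region \<open>y = 0\<close> together with the walks whose first bit is 1 is closed
  under outgoing edges. It misses the target, since these walks stay below \<open>Y\<close>, which
  is at most \<open>n\<close>.\<close>

lemma disconnected_if_down:
  assumes D: "\<And>i. i \<in> strips \<Longrightarrow> D (word \<beta> i)"
  shows "\<not> DConnectivity ns (G \<beta>)"
proof
  define R where "R = {v. v ! k = 0} \<union>
    {pos (word \<beta> i) i t | i t. i \<in> strips \<and> 0 < t \<and> t \<le> L \<and> word \<beta> i 0}"
  have closed: "v \<in> R" if e: "(u, v) \<in> G \<beta>" and u: "u \<in> R" for u v
  proof (cases "u ! k = 0")
    case True
    show ?thesis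
    proof (cases "v ! k = 0")
      \<comment> \<open>Leaving \<open>y = 0\<close> is possible only at a start column whose bit at
        time 0 is 1.\<close>
      case False
      define i where "i = strip_of u"
      have l: "lab (u, v) \<in> labels" "lab (u, v) \<in> \<beta>" and v: "v = u[k := 1]"
        and x: "u ! Suc k = start_column (snd i)" and verts: "u \<in> grid_vertices ns"
        using e True False Y_pos by (auto simp: G_def i_def grid_edges_def)
      have "time_of u = 0" using True x by (simp add: time_of_def i_def)
      then have w0: "word \<beta> i 0" and i: "i \<in> strips"
        using l by (auto simp: lab_def word_def i_def labels_def)
      obtain z y x where u': "u = z @ [y, x]" "z \<in> grid_vertices zs"
        using grid_vertices_ns_cases[OF verts] .
      then have "length z = k" by (simp add: grid_vertices_def k_def)
      then have "v = pos (word \<beta> i) i (Suc 0)"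
        using True x w0 unfolding v u'(1)
        by (simp add: pos_def ups_Suc list_update_append nth_append) (simp add: i_def strip_of_def u'(1))
      then show ?thesis using i w0 L_pos unfolding R_def by fastforce
    qed (simp add: R_def)
  next
    case False
    then obtain i t where i: "i \<in> strips" and t: "0 < t" "t \<le> L" and w0: "word \<beta> i 0"
      and u': "u = pos (word \<beta> i) i t"
      using u by (auto simp: R_def)
    let ?w = "word \<beta> i"
    \<comment> \<open>The free edges at the top are out of reach, so only the edge selected by the
      current bit remains.\<close>
    have "ups ?w t < Y" using ups_mono[OF t(2), of ?w] D_ups[OF D[OF i] w0] by simp
    then have Y: "\<not> Y \<le> u ! k" by (simp add: u' pos_nth[OF i])
    have look: "lab (u, v) = (i, t)"
      using lookup_pos[OF i D_range[OF D[OF i] w0 t(2)]] by (simp add: lab_def u')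
    \<comment> \<open>At \<open>t = L\<close> the label lies outside \<open>labels\<close>, so the
      walk is a dead end. To know this label, the height bound for \<open>D\<close> has to include
      \<open>t = L\<close>.\<close>
    then have "t < L" using e False Y by (auto simp: G_def labels_def)
    moreover have "v = pos ?w i (Suc t)"
      using e False Y look pos_Suc[of i ?w t, OF i] by (auto simp: G_def u' word_def)
    ultimately show ?thesis using i w0 unfolding R_def by fastforce
  qed
  assume "DConnectivity ns (G \<beta>)"
  then have "(replicate (length ns) 0, ns) \<in> (G \<beta>)\<^sup>*" by (simp add: DConnectivity_def)
  then have "ns \<in> R"
  proof (induction rule: rtrancl_induct)
    case base
    have "replicate (length ns) 0 ! k = 0" by (rule nth_replicate) (simp add: length_ns)
    then show ?case unfolding R_def by blast
  qed (use closed in blast)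
  moreover have "ns ! k \<noteq> 0" using ns_nth Y_le Y_pos by simp
  ultimately obtain i t where i: "i \<in> strips" and t: "t \<le> L" and w0: "word \<beta> i 0"
    and ns: "ns = pos (word \<beta> i) i t"
    by (auto simp: R_def)
  have "n = ups (word \<beta> i) t" using ns_nth(1) ns pos_nth(2)[OF i] by metis
  then show False
    using ups_mono[OF t, of "word \<beta> i"] D_ups[OF D[OF i] w0] Y_le by simp
qed

lemma word_flip: "word (flip (i, t) \<beta>) j = (if j = i then flip_at t (word \<beta> i) else word \<beta> j)"
  by (auto simp: word_def fun_eq_iff mem_flip_iff)

lemma flip_subset_labels: "\<beta> \<subseteq> labels \<Longrightarrow> l \<in> labels \<Longrightarrow> flip l \<beta> \<subseteq> labels"
  by (auto simp: flip_def)

text \<open>The 0-inputs have only words in \<open>D\<close>; the 1-inputs have one word in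
  \<open>U\<close> and all others in \<open>D\<close>. A 0-input can be changed in any strip, in at
  least \<open>s\<close> places each, a 1-input in \<open>s\<close> places of its special strip. The
  adversary bound thus gives \<open>s\<close> times the root of the number of strips.\<close>

theorem query_complexity_ge:
  assumes "\<forall>z\<in>set zs. z \<ge> 1"
  shows "real s * sqrt (real (J * prod_list zs)) / 36
    \<le> real (quantum_query_complexity (grid_edges ns) (DConnectivity ns))"
proof -
  define X where "X = {\<beta>. \<beta> \<subseteq> labels \<and> (\<forall>i\<in>strips. D (word \<beta> i))}"
  define X' where "X' = {\<beta>. \<beta> \<subseteq> labels \<and> (\<exists>i\<in>strips. U (word \<beta> i) \<and> (\<forall>j\<in>strips - {i}. D (word \<beta> j)))}"
  have fin_strips: "finite strips" by (simp add: strips_def finite_grid_vertices)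
  have fin: "finite labels" using fin_strips by (simp add: labels_def)
  have card_strips: "J * prod_list zs \<le> card strips"
    using prod_list_le_card_grid_vertices[of zs] by (simp add: strips_def card_cartesian_product)
  have "prod_list zs \<noteq> 0" using assms by (auto simp: prod_list_zero_iff)
  then have strips_pos: "0 < J * prod_list zs" using J_pos by simp
  have "X \<noteq> {}"
  proof -
    obtain w where w: "D w" "\<forall>t\<ge>L. \<not> w t" using D_exists by blast
    have "word {(i, t). i \<in> strips \<and> w t} i = w" if "i \<in> strips" for i
      using that by (simp add: word_def fun_eq_iff)
    moreover have "{(i, t). i \<in> strips \<and> w t} \<subseteq> labels"
      using w(2) by (force simp: labels_def not_le[symmetric])
    ultimately have "{(i, t). i \<in> strips \<and> w t} \<in> X" using w(1) by (auto simp: X_def)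
    then show ?thesis by blast
  qed
  moreover have "card strips * s \<le> card {l \<in> labels. flip l \<beta> \<in> X'}" if \<beta>: "\<beta> \<in> X" for \<beta>
  proof -
    have "card strips * s \<le> card (SIGMA i:strips. {t. t < L \<and> U (flip_at t (word \<beta> i))})"
      using \<beta> by (intro card_dependent_pairs_ge fin_strips D_flips) (auto simp: X_def)
    also have "\<dots> \<le> card {l \<in> labels. flip l \<beta> \<in> X'}"
    proof (rule card_mono)
      show "(SIGMA i:strips. {t. t < L \<and> U (flip_at t (word \<beta> i))}) \<subseteq> {l \<in> labels. flip l \<beta> \<in> X'}"
      proof
        fix l assume "l \<in> (SIGMA i:strips. {t. t < L \<and> U (flip_at t (word \<beta> i))})"
        then obtain i t where l: "l = (i, t)" and i: "i \<in> strips"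
          and t: "t < L" "U (flip_at t (word \<beta> i))"
          by blast
        have "(i, t) \<in> labels" using i t by (simp add: labels_def)
        moreover have "U (word (flip (i, t) \<beta>) i) \<and> (\<forall>j\<in>strips - {i}. D (word (flip (i, t) \<beta>) j))"
          using \<beta> t(2) by (simp add: word_flip X_def)
        ultimately show "l \<in> {l \<in> labels. flip l \<beta> \<in> X'}"
          using \<beta> i flip_subset_labels unfolding l X_def X'_def by blast
      qed
    qed (use fin in simp)
    finally show ?thesis .
  qed
  moreover have "s \<le> card {l \<in> labels. flip l \<beta> \<in> X}" if \<beta>: "\<beta> \<in> X'" for \<beta>
  proof -
    obtain i where i: "i \<in> strips" "U (word \<beta> i)" "\<forall>j\<in>strips - {i}. D (word \<beta> j)"
      using \<beta> by (auto simp: X'_def)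
    let ?S = "{t. t < L \<and> D (flip_at t (word \<beta> i))}"
    have "s \<le> card (Pair i ` ?S)" using U_flips[OF i(2)] by (simp add: card_image inj_on_def)
    also have "\<dots> \<le> card {l \<in> labels. flip l \<beta> \<in> X}"
    proof (rule card_mono)
      show "Pair i ` ?S \<subseteq> {l \<in> labels. flip l \<beta> \<in> X}"
      proof
        fix l assume "l \<in> Pair i ` ?S"
        then obtain t where l: "l = (i, t)" and t: "t < L" "D (flip_at t (word \<beta> i))" by blast
        have "(i, t) \<in> labels" using i t by (simp add: labels_def)
        moreover have "\<forall>j\<in>strips. D (word (flip (i, t) \<beta>) j)"
          using i t(2) by (simp add: word_flip)
        ultimately show "l \<in> {l \<in> labels. flip l \<beta> \<in> X}"
          using \<beta> flip_subset_labels unfolding l X_def X'_def by blast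
      qed
    qed (use fin in simp)
    finally show ?thesis .
  qed
  moreover have "bounded_error_computable (grid_edges ns) (DConnectivity ns)
      (quantum_query_complexity (grid_edges ns) (DConnectivity ns))"
  proof (rule bounded_error_computable_quantum_query_complexity[OF finite_grid_edges grid_edges_nonempty])
    have "1 \<le> n" "1 \<le> q" using Y_le Y_pos fits L_pos J_pos by (auto simp: Suc_le_eq intro: gr0I)
    then show "\<forall>n\<in>set ns. n \<ge> 1" using assms by (auto simp: ns_def)
  qed (simp add: ns_def)
  moreover have "G \<beta> \<subseteq> grid_edges ns" for \<beta> by (auto simp: G_def)
  moreover have "\<not> DConnectivity ns (G \<beta>)" if "\<beta> \<in> X" for \<beta>
    using that by (intro disconnected_if_down) (simp add: X_def)
  moreover have "DConnectivity ns (G \<beta>)" if "\<beta> \<in> X'" for \<beta>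
    using that connected_if_up by (auto simp: X'_def)
  moreover have "X \<subseteq> Pow labels" "X' \<subseteq> Pow labels" by (auto simp: X_def X'_def)
  ultimately have "sqrt (real (card strips * s) * real s) / 36
      \<le> real (quantum_query_complexity (grid_edges ns) (DConnectivity ns))"
    using strips_pos card_strips s_pos
    by (intro adversary_bound[where \<Lambda> = labels and G = G and X = X and Y = X' and lab = lab
          and E = "grid_edges ns" and g = "DConnectivity ns"])
       (auto simp: finite_grid_edges fin G_local)
  moreover have "real s * sqrt (real (J * prod_list zs)) \<le> sqrt (real (card strips * s) * real s)"
  proof -
    have "real s * sqrt (real (J * prod_list zs)) = sqrt (real (J * prod_list zs) * (real s * real s))"
      by (simp add: real_sqrt_mult)
    also have "\<dots> \<le> sqrt (real (card strips) * (real s * real s))"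
      using card_strips by (intro real_sqrt_le_mono mult_right_mono) (auto simp flip: of_nat_mult)
    finally show ?thesis by (simp add: mult.assoc)
  qed
  ultimately show ?thesis by simp
qed

end

section \<open>Choice of the parameters\<close>

abbreviation grid_query_complexity :: "nat list \<Rightarrow> real" where
  "grid_query_complexity ns \<equiv> real (quantum_query_complexity (grid_edges ns) (DConnectivity ns))"

text \<open>One-bit words in \<open>q\<close> strips of width 1 for every value of the other
  coordinates: essentially a disjunction of all their bits.\<close>

lemma grid_query_complexity_flat:
  assumes "1 \<le> n" "1 \<le> q" "\<forall>z\<in>set zs. 1 \<le> z"
  shows "sqrt (real (q * prod_list zs)) / 36 \<le> grid_query_complexity (zs @ [n, q])"
proof -
  interpret walk_family 1 0 1 1 "\<lambda>w. \<not> w 0" "\<lambda>w. w 0" by (rule walk_family_single)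
  interpret strip_grid 1 0 1 1 "\<lambda>w. \<not> w 0" "\<lambda>w. w 0" zs n q q
    using assms by unfold_locales auto
  show ?thesis using query_complexity_ge assms(3) by (simp add: ns_def)
qed

text \<open>Sensitivity \<open>(m + 1) ^ l\<close> is at least \<open>(b / 2) ^ l\<close>. Bounding
  \<open>l\<close> by \<open>2 ^ l\<close> gives \<open>W \<le> 7 * b * 2 ^ l\<close>, and
  \<open>J\<close> is at least \<open>q / (4 * W)\<close>; hence the constant 28.\<close>

lemma grid_query_complexity_deep:
  fixes m l n q :: nat
  defines "b \<equiv> 2 * m + 1"
  assumes m: "1 \<le> m" and n: "28 * b ^ (l + 1) \<le> n" and q: "n \<le> q" and zs: "\<forall>z\<in>set zs. 1 \<le> z"
  shows "(real b / 2) ^ l * sqrt (real q * real (prod_list zs) / (28 * real b * 2 ^ l)) / 36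
    \<le> grid_query_complexity (zs @ [n, q])"
proof -
  define N where "N = b ^ l"
  define H where "H = 2 * m * l + 2"
  define W where "W = 2 * H + 1"
  \<comment> \<open>\<open>N\<close> columns are reserved for the horizontal extent of the
    walks.\<close>
  define J where "J = (q - N) div W"
  have l: "l \<le> 2 ^ l" by (simp add: less_imp_le)
  have pow: "(2::nat) ^ l \<le> N" unfolding N_def b_def using m by (intro power_mono) auto
  have n': "28 * (b * N) \<le> n" using n by (simp add: N_def)
  have N: "N \<le> b * N" by (simp add: b_def)
  have W_le: "W \<le> 7 * b * 2 ^ l"
  proof -
    have "W = 4 * (m * l) + 5" by (simp add: W_def H_def)
    also have "4 * (m * l) \<le> 4 * (m * 2 ^ l)" using l by simp
    also have "4 * (m * 2 ^ l) + 5 \<le> 4 * (m * 2 ^ l) + 5 * 2 ^ l" by simp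
    also have "\<dots> \<le> 7 * b * 2 ^ l" by (simp add: b_def algebra_simps)
    finally show ?thesis by simp
  qed
  have "7 * b * 2 ^ l \<le> 7 * (b * N)" using pow by simp
  then have W4: "4 * W \<le> q" using W_le n' q by linarith
  have W: "0 < W" by (simp add: W_def)
  have Nq: "2 * N \<le> q" using N n' q by linarith
  \<comment> \<open>Reserving \<open>N\<close> columns costs at most a factor 2 as
    \<open>2 * N \<le> q\<close>; rounding costs another as \<open>4 * W \<le> q\<close>.\<close>
  have J_ge: "real q / (4 * real W) \<le> real J"
  proof -
    have "q - N < (J + 1) * W"
      unfolding J_def using W by (simp add: dividend_less_div_times)
    then have "q < 2 * ((J + 1) * W)" using Nq by linarith
    then have "q < 2 * (J * W) + 2 * W" by simp
    then have "q \<le> 4 * (J * W)" using W4 by linarith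
    then have "real q \<le> real (4 * (J * W))" by (simp only: of_nat_le_iff)
    then have "real q \<le> real J * (4 * real W)" by simp
    then show ?thesis using W by (simp add: divide_le_eq)
  qed
  have JW: "J * W \<le> q - N" by (simp add: J_def)
  have J_pos: "0 < J"
  proof -
    have "W \<le> q - N" using W4 Nq by linarith
    then show ?thesis using W by (simp add: J_def div_greater_zero_iff)
  qed
  have Y: "Suc ((N + 1) div 2) \<le> n"
  proof -
    have "1 \<le> N" by (simp add: N_def b_def)
    then have "Suc ((N + 1) div 2) \<le> 2 * N" by linarith
    then show ?thesis using N n' by linarith
  qed
  define F where "F = (\<lambda>v w. w 0 \<and> balanced m l (\<lambda>t. w (Suc t)) \<and> majority m l (\<lambda>t. w (Suc t)) = v)"
  have fam: "walk_family (N + 1) H (Suc ((N + 1) div 2)) ((m + 1) ^ l) (F False) (F True)"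
    unfolding N_def b_def H_def F_def by (rule walk_family_balanced)
  have "J * W + N \<le> q" using JW Nq by arith
  then have "J * (2 * H + 1) + (N + 1) \<le> q + 1"
    unfolding W_def[symmetric] add.assoc[symmetric] by (rule add_right_mono)
  with fam Y J_pos
  have grid: "strip_grid (N + 1) H (Suc ((N + 1) div 2)) ((m + 1) ^ l) (F False) (F True) n q J"
    by (intro strip_grid.intro strip_grid_axioms.intro)
  have "real q * real (prod_list zs) / (28 * real b * 2 ^ l) \<le> real (J * prod_list zs)"
  proof -
    have "real W \<le> real (7 * b * 2 ^ l)" using W_le by (simp only: of_nat_le_iff)
    then have "real q / (28 * real b * 2 ^ l) \<le> real q / (4 * real W)"
      using W by (intro divide_left_mono) auto
    then have "real q / (28 * real b * 2 ^ l) \<le> real J" using J_ge by linarith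
    then show ?thesis
      using mult_right_mono[of "real q / (28 * real b * 2 ^ l)" "real J" "real (prod_list zs)"] by simp
  qed
  moreover have "(real b / 2) ^ l \<le> real ((m + 1) ^ l)"
    unfolding of_nat_power by (intro power_mono) (auto simp: b_def)
  ultimately have "(real b / 2) ^ l * sqrt (real q * real (prod_list zs) / (28 * real b * 2 ^ l))
     \<le> real ((m + 1) ^ l) * sqrt (real (J * prod_list zs))"
    by (intro mult_mono real_sqrt_le_mono) auto
  also have "\<dots> / 36 \<le> grid_query_complexity (zs @ [n, q])"
    using strip_grid.query_complexity_ge[OF grid zs] unfolding strip_grid.ns_def[OF grid] by simp
  finally show ?thesis by simp
qed

text \<open>Used with \<open>p = 2 ^ l\<close>, \<open>\<beta> = b ^ l\<close> and
  \<open>r = q * P\<close>. In \<open>28 ^ 3 * b ^ 5\<close>, two factors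
  \<open>28 * b\<^sup>2\<close> come from the upper bound on \<open>n\<close> and one factor
  \<open>28 * b\<close> from the number of strips.\<close>

lemma balance_identity:
  fixes b p \<beta> r :: real
  assumes "0 < b" "0 < p"
  shows "28 ^ 3 * b ^ 5 * ((p * p)\<^sup>2 * ((\<beta> / p)\<^sup>2 * (r / (28 * b * p))))
    = (28 * (\<beta> * b\<^sup>2)) * (28 * (\<beta> * b\<^sup>2)) * r * p"
proof -
  have "(p * p)\<^sup>2 * ((\<beta> / p)\<^sup>2 * (r / (28 * b * p))) = \<beta> * \<beta> * r * p / (28 * b)"
    using assms by (simp add: power2_eq_square)
  then show ?thesis using assms by (simp add: eval_nat_numeral)
qed
theorem theorem12:
  fixes d :: nat and \<epsilon> :: real
  assumes "d \<ge> 2" and "\<epsilon> > 0"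
  shows "\<exists>c::real. c > 0 \<and>
    (\<forall>ns :: nat list. length ns = d \<and> sorted ns \<and> (\<forall>n\<in>set ns. n \<ge> 1) \<longrightarrow>
       real (quantum_query_complexity (grid_edges ns) (DConnectivity ns))
         \<ge> c * real (ns ! (d - 2) * prod_list ns) powr (1 / 2 - \<epsilon>))"
proof -
  \<comment> \<open>This makes \<open>b powr \<epsilon>\<close> at least 4, so that a loss of 4 per
    level is absorbed by the \<epsilon> in the exponent.\<close>
  obtain m :: nat where m: "4 powr (1 / \<epsilon>) < real m" using reals_Archimedean2 by blast
  define b where "b = 2 * m + 1"
  have "(1::real) \<le> 4 powr (1 / \<epsilon>)" using assms(2) by (intro ge_one_powr_ge_zero) auto
  then have m1: "1 \<le> m" using m by linarith
  have b2: "2 \<le> b" using m1 by (simp add: b_def)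
  have b_powr: "4 \<le> real b powr \<epsilon>"
  proof -
    have "4 = (4 powr (1 / \<epsilon>)) powr \<epsilon>" using assms(2) by (simp add: powr_powr)
    also have "\<dots> \<le> real b powr \<epsilon>" using m assms(2) by (intro powr_mono2) (auto simp: b_def)
    finally show ?thesis .
  qed
  define C where "C = sqrt (28 ^ 3 * real b ^ 5)"
  have C: "0 < C" using b2 by (simp add: C_def)
  show ?thesis
  proof (intro exI[of _ "1 / (36 * C)"] conjI allI impI)
    show "0 < 1 / (36 * C)" using C by simp
    fix ns :: "nat list"
    assume "length ns = d \<and> sorted ns \<and> (\<forall>n\<in>set ns. n \<ge> 1)"
    then have len: "length ns = d" and sorted: "sorted ns" and ge1: "\<forall>n\<in>set ns. n \<ge> 1" by auto
    define zs where "zs = take (d - 2) ns"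
    define n where "n = ns ! (d - 2)"
    define q where "q = ns ! (d - 1)"
    define P where "P = prod_list zs"
    have "drop (d - 2) ns = [n, q]"
      using len assms(1) Cons_nth_drop_Suc[of "d - 2" ns] Cons_nth_drop_Suc[of "d - 1" ns]
      by (simp add: n_def q_def Suc_diff_Suc numeral_2_eq_2)
    then have ns: "ns = zs @ [n, q]" unfolding zs_def by (metis append_take_drop_id)
    have nq: "n \<le> q" "1 \<le> n" "1 \<le> q" and zs: "\<forall>z\<in>set zs. 1 \<le> z"
      using sorted ge1 by (auto simp: ns sorted_append)
    have "P \<noteq> 0" using zs unfolding P_def by (auto simp: prod_list_zero_iff)
    then have P: "1 \<le> P" by simp
    define M where "M = real n * real n * real q * real P"
    have M_eq: "real (ns ! (d - 2) * prod_list ns) = M"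
    proof -
      have "prod_list ns = P * n * q" by (simp add: ns P_def mult.assoc)
      then show ?thesis by (simp add: n_def[symmetric] M_def)
    qed
    have M_nat: "M = real (n * n * q * P)" by (simp add: M_def)
    have "n * 1 * 1 * 1 \<le> n * n * q * P" using nq P by (intro mult_le_mono) auto
    then have M_n: "real n \<le> M" unfolding M_nat of_nat_le_iff by simp
    then have M1: "1 \<le> M" using nq(2) by linarith
    have "M powr (1 / 2 - \<epsilon>) / C / 36 \<le> grid_query_complexity ns"
    \<comment> \<open>For \<open>n\<close> below a constant, the factor \<open>n * n\<close> in
      \<open>M\<close> goes into \<open>C\<close> and one-bit words suffice.\<close>
    proof (cases "28 * b \<le> n")
      case False
      have "M powr (1 / 2 - \<epsilon>) \<le> M powr (1 / 2)" using M1 assms(2) by (intro powr_mono) auto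
      also have "\<dots> = sqrt M" using M1 by (simp add: powr_half_sqrt)
      also have "\<dots> \<le> sqrt (28 ^ 3 * real b ^ 5 * (real q * real P))"
      proof (rule real_sqrt_le_mono)
        have "real n * real n \<le> (28 * real b) * (28 * real b)"
          using False by (intro mult_mono) auto
        also have "\<dots> = 28 ^ 2 * real b ^ 2" by (simp add: power2_eq_square)
        also have "\<dots> \<le> 28 ^ 3 * real b ^ 5"
          using b2 by (intro mult_mono power_increasing) auto
        finally have "real n * real n * (real q * real P) \<le> 28 ^ 3 * real b ^ 5 * (real q * real P)"
          by (rule mult_right_mono) simp
        then show "M \<le> 28 ^ 3 * real b ^ 5 * (real q * real P)" by (simp add: M_def mult.assoc)
      qed
      also have "\<dots> = C * sqrt (real (q * P))" by (simp add: C_def real_sqrt_mult)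
      finally have "M powr (1 / 2 - \<epsilon>) / C \<le> sqrt (real (q * P))"
        using C by (simp add: divide_le_eq mult.commute)
      then show ?thesis
        using divide_right_mono[of _ _ 36] grid_query_complexity_flat[OF nq(2,3) zs] order_trans
        unfolding ns P_def by fastforce
    next
      case True
      \<comment> \<open>The largest depth that fits:
        \<open>28 * b ^ (l + 1) \<le> n < 28 * b ^ (l + 2)\<close>.\<close>
      define l where "l = (LEAST l. n < 28 * b ^ (l + 2))"
      have "n < 28 * b ^ (n + 2)"
      proof -
        have "n < b ^ n" using b2 by (intro power_gt_expt) auto
        also have "\<dots> \<le> b ^ (n + 2)" using b2 by (intro power_increasing) auto
        finally show ?thesis by simp
      qed
      then have upper: "n < 28 * b ^ (l + 2)" unfolding l_def by (rule LeastI)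
      have lower: "28 * b ^ (l + 1) \<le> n"
      proof (cases l)
        case (Suc l')
        then have "l' < (LEAST l. n < 28 * b ^ (l + 2))" by (simp only: l_def[symmetric] lessI)
        then have "\<not> n < 28 * b ^ (l' + 2)" by (rule not_less_Least)
        then show ?thesis unfolding Suc by simp
      next
        case 0
        show ?thesis using True unfolding 0 by simp
      qed
      have "4 ^ l \<le> (real b powr \<epsilon>) ^ l" using b_powr by (intro power_mono) auto
      also have "\<dots> = (real b ^ l) powr \<epsilon>"
      proof -
        have b0: "0 < real b" using b2 by simp
        have "(real b powr \<epsilon>) ^ l = real b powr (\<epsilon> * real l)"
          using b0 by (simp add: powr_powr flip: powr_realpow)
        also have "\<dots> = (real b powr real l) powr \<epsilon>" by (simp only: powr_powr mult.commute)
        finally show ?thesis using b0 by (simp only: powr_realpow)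
      qed
      also have "\<dots> \<le> M powr \<epsilon>"
      proof (rule powr_mono2)
        have "b ^ l \<le> b ^ (l + 1)" using b2 by (intro power_increasing) auto
        then have "b ^ l \<le> n" using lower by linarith
        then have "real (b ^ l) \<le> real n" by (simp only: of_nat_le_iff)
        then show "real b ^ l \<le> M" using M_n unfolding of_nat_power by (rule order_trans)
      qed (use assms(2) in auto)
      finally have four: "4 ^ l \<le> M powr \<epsilon>" .
      let ?r = "(real b / 2) ^ l * sqrt (real q * real P / (28 * real b * 2 ^ l))"
      have "M \<le> (C * 4 ^ l * ?r)\<^sup>2"
      proof -
        have "real n \<le> real (28 * b ^ (l + 2))" using upper by (simp only: of_nat_le_iff less_imp_le)
        then have "real n \<le> 28 * real b ^ (l + 2)" by simp
        then have "real n * real n \<le> (28 * real b ^ (l + 2)) * (28 * real b ^ (l + 2))"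
          by (intro mult_mono) auto
        then have "M \<le> (28 * real b ^ (l + 2)) * (28 * real b ^ (l + 2)) * (real q * real P)"
          unfolding M_def mult.assoc[of _ "real q"] by (rule mult_right_mono) simp
        \<comment> \<open>The true loss is \<open>2 ^ l\<close> in sensitivity and the root of
          \<open>2 ^ l\<close> in the number of strips. Compensating by \<open>4 ^ l\<close>
          overshoots, which leaves the extra \<open>2 ^ l\<close> after squaring.\<close>
        also have "\<dots> \<le> (28 * real b ^ (l + 2)) * (28 * real b ^ (l + 2)) * (real q * real P) * 2 ^ l"
        proof -
          have "x \<le> x * 2 ^ l" if "0 \<le> x" for x :: real
            using mult_left_mono[OF one_le_power[of "2::real" l] that] by simp
          then show ?thesis by simp
        qed
        also have "\<dots> = (C * 4 ^ l * ?r)\<^sup>2"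
        proof -
          define \<beta> p where "\<beta> = real b ^ l" and "p = (2::real) ^ l"
          have pos: "0 < p" "0 < real b" using b2 by (simp_all add: p_def)
          have 4: "(4::real) ^ l = p * p" by (simp add: p_def flip: power_mult_distrib)
          have "(C * (p * p) * (\<beta> / p * sqrt (real q * real P / (28 * real b * p))))\<^sup>2
              = C\<^sup>2 * ((p * p)\<^sup>2 * ((\<beta> / p)\<^sup>2 * (sqrt (real q * real P / (28 * real b * p)))\<^sup>2))"
            by (simp only: power_mult_distrib mult.assoc)
          also have "(sqrt (real q * real P / (28 * real b * p)))\<^sup>2 = real q * real P / (28 * real b * p)"
            using pos by (intro real_sqrt_pow2) simp
          also have "C\<^sup>2 = 28 ^ 3 * real b ^ 5" unfolding C_def by (rule real_sqrt_pow2) simp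
          also note balance_identity[OF pos(2,1)]
          finally show ?thesis by (simp only: 4 power_divide power_add \<beta>_def[symmetric] p_def[symmetric])
        qed
        finally show ?thesis .
      qed
      then have "sqrt M \<le> C * 4 ^ l * ?r"
        using C by (intro real_le_lsqrt) auto
      also have "\<dots> \<le> C * M powr \<epsilon> * ?r"
        using four C by (intro mult_right_mono mult_left_mono) auto
      finally have "sqrt M \<le> ?r * (C * M powr \<epsilon>)" by (simp only: mult.commute)
      then have "sqrt M / (C * M powr \<epsilon>) \<le> ?r"
        using C M1 by (subst pos_divide_le_eq) auto
      moreover have "M powr (1 / 2 - \<epsilon>) / C = sqrt M / (C * M powr \<epsilon>)"
        using M1 by (simp add: powr_diff powr_half_sqrt)
      ultimately have "M powr (1 / 2 - \<epsilon>) / C \<le> ?r" by simp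
      then show ?thesis
        using grid_query_complexity_deep[of m l n q zs] m1 lower nq(1) zs
        unfolding ns P_def b_def by simp
    qed
    then show "real (quantum_query_complexity (grid_edges ns) (DConnectivity ns))
         \<ge> 1 / (36 * C) * real (ns ! (d - 2) * prod_list ns) powr (1 / 2 - \<epsilon>)"
      unfolding M_eq by (simp add: mult.commute)
  qed
qed

end
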